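(* Let $n\ge 2$ and $1\le d<n$. The $d$-plane Radon transform $R_d$ is an injective, linear, continuous map $\mathcal{T}\to\mathcal{T}^{G^n_d}$, where continuity means that for every $A\in G^n_d$ the map $f\mapsto R_df(\cdot,A)$ is continuous $\mathcal{T}\to\mathcal{T}$. It also extends to an injective, linear, continuous map $\mathcal{T}'\to(\mathcal{T}')^{G^n_d}$ (again, continuity means that for every $A\in G^n_d$ the map $f\mapsto R_df(\cdot,A)$ is continuous $\mathcal{T}'\to\mathcal{T}'$).
   Context: $\mathbb{T}^n=\mathbb{R}^n/\mathbb{Z}^n$ is the standard flat torus. $\mathcal{T}=C^\infty(\mathbb{T}^n)$ (complex-valued), with the topology induced by the seminorms $\phi\mapsto\sup_{|\alpha|\le N}\sup_{\mathbb{T}^n}|\partial^\alpha\phi|$, $N\in\mathbb{N}$. $\mathcal{T}'$ is its dual, the space of distributions on $\mathbb{T}^n$, with the weak star topology; $\langle\cdot,\cdot\rangle$ is the bilinear duality pairing between $\mathcal{T}'$ and $\mathcal{T}$ extending $\int_{\mathbb{T}^n}f\eta\,dx$. $B^A$ denotes the set of all maps $A\to B$. $G^n_d$ is the set of unordered linearly independent $d$-tuples $A=\{v_1,\dots,v_d\}$ of vectors in $\mathbb{Z}^n\setminus\{0\}$. For $f\in\mathcal{T}$, $x\in\mathbb{T}^n$ and $A=\{v_1,\dots,v_d\}\in G^n_d$, the $d$-plane Radon transform is $$R_df(x,A)=\int_{[0,1]^d}f(x+t_1v_1+\dots+t_dv_d)\,dt_1\cdots dt_d,$$ regarded as an element $A\mapsto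 R_df(\cdot,A)$ of $\mathcal{T}^{G^n_d}$. For $f\in\mathcal{T}'$ the distribution $R_df(\cdot,A)\in\mathcal{T}'$ is defined by $\langle R_df(\cdot,A),\eta\rangle=\langle f,R_d\eta(\cdot,A)\rangle$ for all $\eta\in\mathcal{T}$; this is the extension referred to in the claim. *)

theory Defs
  imports "HOL-Analysis.Analysis"
begin

definition partial_deriv ::
    "'n::finite \<Rightarrow> (real^'n \<Rightarrow> complex) \<Rightarrow> real^'n \<Rightarrow> complex" where
  "partial_deriv i f x = frechet_derivative f (at x) (axis i 1)"

primrec C_k :: "nat \<Rightarrow> (real^'n::finite \<Rightarrow> complex) \<Rightarrow> bool" where
  "C_k 0 f \<longleftrightarrow> continuous_on UNIV f"
| "C_k (Suc k) f \<longleftrightarrow> f differentiable_on UNIV \<and> (\<forall>i. C_k k (partial_deriv i f))"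

definition int_lattice :: "(real^'n::finite) set" where
  "int_lattice = {v. \<forall>i. v $ i \<in> \<int>}"

(* Functions on the torus R^n / Z^n are represented by their lifts to R^n, i.e. by functions
   invariant under translation by integer vectors. *)
definition test_functions :: "(real^'n::finite \<Rightarrow> complex) set" where
  "test_functions =
     {f. (\<forall>k. C_k k f) \<and> (\<forall>x. \<forall>v\<in>int_lattice. f (x + v) = f x)}"

(* Multi-indices are functions 'n => nat. The index type carries no order, so an enumeration of
   it is chosen; on smooth functions the order of differentiation does not matter. *)
definition index_list :: "'n::finite list" where
  "index_list = (SOME is. distinct is \<and> set is = UNIV)"

definition multi_deriv ::
    "('n::finite \<Rightarrow> nat) \<Rightarrow> (real^'n \<Rightarrow> complex) \<Rightarrow> real^'n \<Rightarrow> complex" where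
  "multi_deriv \<alpha> f = foldr (\<lambda>i. partial_deriv i ^^ \<alpha> i) index_list f"

definition test_seminorm :: "nat \<Rightarrow> (real^'n::finite \<Rightarrow> complex) \<Rightarrow> real" where
  "test_seminorm N f =
     (SUP \<alpha>\<in>{\<alpha>. sum \<alpha> UNIV \<le> N}. SUP x. cmod (multi_deriv \<alpha> f x))"

definition test_topology :: "(real^'n::finite \<Rightarrow> complex) topology" where
  "test_topology = topology_generated_by
     {{g \<in> test_functions. test_seminorm N (\<lambda>x. g x - f x) < e} | f N e.
        f \<in> test_functions \<and> 0 < e}"

(* A distribution is a functional on test_functions; making it extensional there ensures that
   equality of distributions is equality on all test functions. The pairing of a distribution u
   with a test function \<eta> is the application u \<eta>. *)
definition distributions :: "((real^'n::finite \<Rightarrow> complex) \<Rightarrow> complex) set" where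
  "distributions =
     {u \<in> extensional test_functions.
        (\<forall>f\<in>test_functions. \<forall>g\<in>test_functions. \<forall>a b.
           u (\<lambda>x. a * f x + b * g x) = a * u f + b * u g) \<and>
        continuous_map test_topology euclidean u}"

definition weak_star_topology ::
    "((real^'n::finite \<Rightarrow> complex) \<Rightarrow> complex) topology" where
  "weak_star_topology =
     subtopology (product_topology (\<lambda>_. euclidean) test_functions) distributions"

definition distribution_of ::
    "(real^'n::finite \<Rightarrow> complex) \<Rightarrow> (real^'n \<Rightarrow> complex) \<Rightarrow> complex" where
  "distribution_of f = (\<lambda>\<eta>\<in>test_functions. LINT x:cbox 0 1|lborel. f x * \<eta> x)"

definition direction_sets :: "nat \<Rightarrow> (real^'n::finite) set set" where
  "direction_sets d = {A. A \<subseteq> int_lattice - {0} \<and> card A = d \<and> independent A}"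

(* Since A is unordered, the integration variables are indexed by the elements of A themselves:
   t ranges over the cube [0,1]^A, with Lebesgue measure on R^A. *)
definition radon ::
    "nat \<Rightarrow> (real^'n::finite \<Rightarrow> complex) \<Rightarrow> (real^'n) set \<Rightarrow> real^'n \<Rightarrow> complex" where
  "radon d f = (\<lambda>A\<in>direction_sets d. \<lambda>x.
     LINT t:(A \<rightarrow>\<^sub>E {0..1})|(\<Pi>\<^sub>M v\<in>A. lborel). f (x + (\<Sum>v\<in>A. t v *\<^sub>R v)))"

definition radon_distr ::
    "nat \<Rightarrow> ((real^'n::finite \<Rightarrow> complex) \<Rightarrow> complex) \<Rightarrow>
      (real^'n) set \<Rightarrow> (real^'n \<Rightarrow> complex) \<Rightarrow> complex" where
  "radon_distr d u = (\<lambda>A\<in>direction_sets d. \<lambda>\<eta>\<in>test_functions. u (radon d \<eta> A))"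

end

theory Submission imports Defs begin

text \<open>The transform \<open>R f (\<cdot>, A)\<close> averages \<open>f\<close> along the segments \<open>x + [0,1] v\<close>, one direction
\<open>v \<in> A\<close> after another. By Fubini it is a composition of operators
\<open>f \<mapsto> \<integral>\<^sub>0\<^sup>1 k(t) f(x + t v) dt\<close> with weight \<open>k = 1\<close> (\<open>plane_integral_insert\<close>). Such an operator is a
superposition of translations, so it commutes with all partial derivatives and does not increase
sup norms when \<open>\<bar>k\<bar> \<le> 1\<close>. Hence \<open>R\<close> maps smooth functions to smooth functions and increases no
seminorm, which gives continuity on test functions and, by transposition, on distributions. The
transposed operator extends the original one because averaging over \<open>x + [0,1] v\<close> with an integer
vector \<open>v\<close> is symmetric for the pairing \<open>\<integral> f g\<close>: translations preserve the integral over the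
torus, and \<open>t \<mapsto> -t\<close> preserves the integral over a period (\<open>plane_integral_adjoint\<close>).

Injectivity rests on one observation. If the frequency \<open>k\<close> is orthogonal to every \<open>v \<in> A\<close>, the
character \<open>x \<mapsto> exp (2 \<pi> i k \<bullet> x)\<close> is constant along the planes spanned by \<open>A\<close>, so
\<open>R\<close> fixes it. Since \<open>d < n\<close>, every \<open>k\<close> admits such an \<open>A\<close> (\<open>orthogonal_direction_set\<close>), and
therefore \<open>R u\<close> determines the pairing of a distribution \<open>u\<close> with every character, that is, all
its Fourier coefficients. A distribution is determined by those
(\<open>distribution_eq_0_if_characters\<close>), because trigonometric polynomials are dense in the test
functions.

Density is obtained one coordinate at a time: convolving in the coordinate \<open>j\<close> with the
normalised kernel \<open>cos (\<pi> t)\<^bsup>2m\<^esup>\<close> replaces \<open>g\<close> by a finite sum of its Fourier modes in that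
coordinate, and the result converges to \<open>g\<close> with all derivatives (\<open>axis_smoothing_error\<close>). Once
a function is a pure mode in all coordinates it is a multiple of a character. Injectivity on
functions follows from injectivity on distributions, since a function \<open>q\<close> that pairs to zero with
its own conjugate satisfies \<open>\<integral>\<bar>q\<bar>\<^sup>2 = 0\<close>.\<close>

section \<open>Weighted averages of smooth periodic functions along segments\<close>

text \<open>Fubini arguments and translation invariance only need continuity, and products and translates of
functions come up in them; this class is closed under both without any differentiation.\<close>

definition periodic_continuous :: "(real^'n::finite \<Rightarrow> complex) set" where
  "periodic_continuous =
     {f. continuous_on UNIV f \<and> (\<forall>x. \<forall>v\<in>int_lattice. f (x + v) = f x)}"

text \<open>Three weights matter: \<open>k = 1\<close> builds the Radon transform, \<open>k(t) = exp (-2 \<pi> i m t)\<close> extracts a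
Fourier mode, and a normalised power of \<open>cos (\<pi> t)\<close> is an approximate identity. Treating them as
one operator means that smoothness, commutation with derivatives and sup bounds are proved once.\<close>

definition line_average ::
    "(real \<Rightarrow> complex) \<Rightarrow> real^'n::finite \<Rightarrow> (real^'n \<Rightarrow> complex) \<Rightarrow> real^'n \<Rightarrow> complex" where
  "line_average k v f x = integral {0..1} (\<lambda>t. k t * f (x + t *\<^sub>R v))"

lemma periodic_continuous_shift:
  "f \<in> periodic_continuous \<Longrightarrow> v \<in> int_lattice \<Longrightarrow> f (x + v) = f x"
  by (simp add: periodic_continuous_def)

lemma axis_in_int_lattice [simp]: "axis i 1 \<in> int_lattice"
  by (simp add: int_lattice_def axis_def)

lemma test_functions_differentiable:
  "f \<in> test_functions \<Longrightarrow> f differentiable_on UNIV"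
  unfolding test_functions_def by (auto dest: spec[of _ "Suc 0"])

lemma test_functions_frechet:
  "f \<in> test_functions \<Longrightarrow> (f has_derivative frechet_derivative f (at x)) (at x)"
  using test_functions_differentiable[of f]
  by (simp add: differentiable_on_def frechet_derivative_works)

lemma test_functions_periodic:
  "f \<in> test_functions \<Longrightarrow> v \<in> int_lattice \<Longrightarrow> f (x + v) = f x"
  by (simp add: test_functions_def)

lemma test_functions_continuous: "f \<in> test_functions \<Longrightarrow> continuous_on UNIV f"
  by (simp add: differentiable_imp_continuous_on test_functions_differentiable)

lemma test_functions_periodic_continuous:
  "f \<in> test_functions \<Longrightarrow> f \<in> periodic_continuous"
  by (simp add: periodic_continuous_def test_functions_continuous test_functions_periodic)

lemma partial_deriv_test_functions:
  fixes f :: "real^'n::finite \<Rightarrow> complex"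
  assumes f: "f \<in> test_functions"
  shows "partial_deriv i f \<in> test_functions"
proof -
  have "C_k k (partial_deriv i f)" for k
    using f unfolding test_functions_def by (auto dest: spec[of _ "Suc k"])
  moreover have "partial_deriv i f (x + v) = partial_deriv i f x" if v: "v \<in> int_lattice" for x v
  proof -
    have "((\<lambda>y. f (y + v)) has_derivative (\<lambda>h. frechet_derivative f (at (x + v)) h)) (at x)"
      by (rule has_derivative_compose[OF _ test_functions_frechet[OF f]])
        (auto intro!: derivative_eq_intros)
    then have "(f has_derivative (\<lambda>h. frechet_derivative f (at (x + v)) h)) (at x)"
      by (simp add: test_functions_periodic[OF f v])
    then show ?thesis
      unfolding partial_deriv_def using frechet_derivative_at by metis
  qed
  ultimately show ?thesis by (simp add: test_functions_def)
qed

text \<open>Smoothness by coinduction: a family of differentiable functions that is closed under partial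
derivatives consists of smooth functions. This replaces an induction on the order of
differentiability in every membership proof below.\<close>

lemma test_functions_coinduct:
  fixes f :: "real^'n::finite \<Rightarrow> complex"
  assumes "f \<in> F"
    and diff: "\<And>g. g \<in> F \<Longrightarrow> g differentiable_on UNIV"
    and closed: "\<And>g i. g \<in> F \<Longrightarrow> partial_deriv i g \<in> F"
    and periodic: "\<And>g x v. g \<in> F \<Longrightarrow> v \<in> int_lattice \<Longrightarrow> g (x + v) = g x"
  shows "f \<in> test_functions"
proof -
  have "C_k k g" if "g \<in> F" for k g
    using that
    by (induction k arbitrary: g) (auto simp: diff closed differentiable_imp_continuous_on)
  then show ?thesis using assms by (auto simp: test_functions_def)
qed

lemma partial_deriv_unique:
  "(f has_derivative D) (at x) \<Longrightarrow> partial_deriv i f x = D (axis i 1)"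
  unfolding partial_deriv_def using frechet_derivative_at by metis

lemma line_average_integrand_continuous:
  fixes f :: "real^'n::finite \<Rightarrow> complex"
  assumes "continuous_on {0..1} k" and f: "continuous_on UNIV f"
  shows "continuous_on {0..1} (\<lambda>t. k t * f (x + t *\<^sub>R v))"
  by (intro continuous_intros assms continuous_on_compose2[OF f]) auto

lemma line_average_integrable:
  fixes f :: "real^'n::finite \<Rightarrow> complex"
  assumes "continuous_on {0..1} k" "continuous_on UNIV f"
  shows "(\<lambda>t. k t * f (x + t *\<^sub>R v)) integrable_on {0..1}"
  by (intro integrable_continuous_real line_average_integrand_continuous assms)

text \<open>Differentiation under the integral sign. The derivative of the integrand is continuous as a map
into the bounded linear operators because its components are the continuous partial derivatives.\<close>

lemma line_average_has_derivative:
  fixes f :: "real^'n::finite \<Rightarrow> complex"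
  assumes k: "continuous_on {0..1} k" and f: "f \<in> test_functions"
  obtains D where "(line_average k v f has_derivative D) (at x)"
    and "\<And>i. D (axis i 1) = line_average k v (partial_deriv i f) x"
proof -
  define L where "L x t = Blinfun (\<lambda>h. k t * frechet_derivative f (at (x + t *\<^sub>R v)) h)" for x t
  have bl: "bounded_linear (\<lambda>h. k t * frechet_derivative f (at (x + t *\<^sub>R v)) h)" for x t
    by (intro bounded_linear_const_mult has_derivative_bounded_linear[OF test_functions_frechet[OF f]])
  have L: "blinfun_apply (L x t) = (\<lambda>h. k t * frechet_derivative f (at (x + t *\<^sub>R v)) h)" for x t
    unfolding L_def by (rule bounded_linear_Blinfun_apply[OF bl])
  have Li: "L x t (axis i 1) = k t * partial_deriv i f (x + t *\<^sub>R v)" for x t i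
    by (simp add: L partial_deriv_def)
  have cont: "continuous_on (UNIV \<times> cbox 0 1) (\<lambda>(x, t). L x t)"
  proof (rule continuous_on_blinfun_componentwise)
    fix b :: "real^'n" assume "b \<in> Basis"
    then obtain i where b: "b = axis i 1" by (auto simp: Basis_vec_def)
    have "continuous_on (UNIV \<times> cbox 0 1) (\<lambda>p. k (snd p) * partial_deriv i f (fst p + snd p *\<^sub>R v))"
      by (intro continuous_intros continuous_on_compose2[OF k] continuous_on_compose2
          [OF test_functions_continuous[OF partial_deriv_test_functions[OF f]]]) auto
    then show "continuous_on (UNIV \<times> cbox 0 1) (\<lambda>p. blinfun_apply (case p of (x, t) \<Rightarrow> L x t) b)"
      by (simp add: split_beta b Li)
  qed
  have "((\<lambda>x. integral (cbox 0 1) (\<lambda>t. k t * f (x + t *\<^sub>R v))) has_derivative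
      integral (cbox 0 1) (L x)) (at x within UNIV)"
  proof (rule leibniz_rule[where U = UNIV and fx = L])
    show "((\<lambda>x. k t * f (x + t *\<^sub>R v)) has_derivative blinfun_apply (L x t)) (at x within UNIV)" for x t
      unfolding L
      by (intro has_derivative_mult_right has_derivative_compose[OF _ test_functions_frechet[OF f]])
        (auto intro!: derivative_eq_intros)
    show "(\<lambda>t. k t * f (x + t *\<^sub>R v)) integrable_on cbox 0 1" for x
      using line_average_integrable[OF k test_functions_continuous[OF f]] by simp
  qed (use cont in auto)
  moreover have "blinfun_apply (integral (cbox 0 1) (L x)) (axis i 1) =
      line_average k v (partial_deriv i f) x" for i
  proof -
    have "continuous_on (cbox 0 1) (\<lambda>t. (\<lambda>(x, t). L x t) (x, t))"
      by (intro continuous_on_compose2[OF cont] continuous_intros) auto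
    then have "L x integrable_on cbox 0 1"
      by (intro integrable_continuous) simp
    then show ?thesis
      by (simp add: blinfun_apply_integral Li line_average_def)
  qed
  ultimately show ?thesis
    by (intro that[of "blinfun_apply (integral (cbox 0 1) (L x))"]) (simp_all add: line_average_def[abs_def])
qed

lemma partial_deriv_line_average:
  fixes f :: "real^'n::finite \<Rightarrow> complex"
  assumes "continuous_on {0..1} k" and "f \<in> test_functions"
  shows "partial_deriv i (line_average k v f) = line_average k v (partial_deriv i f)"
  using line_average_has_derivative[OF assms] partial_deriv_unique by (metis ext)

lemma line_average_test_functions:
  fixes f :: "real^'n::finite \<Rightarrow> complex"
  assumes k: "continuous_on {0..1} k" and f: "f \<in> test_functions"
  shows "line_average k v f \<in> test_functions"
proof (rule test_functions_coinduct[where F = "line_average k v ` test_functions"])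
  fix g :: "real^'n \<Rightarrow> complex" and i assume "g \<in> line_average k v ` test_functions"
  then obtain h where h: "h \<in> test_functions" "g = line_average k v h" by auto
  show "g differentiable_on UNIV"
    unfolding differentiable_on_def differentiable_def h(2)
    using line_average_has_derivative[OF k h(1)] by auto metis
  show "partial_deriv i g \<in> line_average k v ` test_functions"
    by (simp add: h partial_deriv_line_average[OF k] partial_deriv_test_functions)
  show "g (x + w) = g x" if "w \<in> int_lattice" for x w
  proof -
    have "h (x + w + t *\<^sub>R v) = h (x + t *\<^sub>R v)" for t
      using test_functions_periodic[OF h(1) that, of "x + t *\<^sub>R v"] by (simp add: add_ac)
    then show ?thesis by (simp add: h(2) line_average_def)
  qed
qed (use f in auto)

lemma test_functions_lincomb_has_derivative:
  fixes f g :: "real^'n::finite \<Rightarrow> complex"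
  assumes f: "f \<in> test_functions" and g: "g \<in> test_functions"
  shows "((\<lambda>x. a * f x + b * g x) has_derivative
    (\<lambda>h. a * frechet_derivative f (at x) h + b * frechet_derivative g (at x) h)) (at x)"
  by (intro has_derivative_add has_derivative_mult_right test_functions_frechet assms)

lemma partial_deriv_lincomb:
  fixes f g :: "real^'n::finite \<Rightarrow> complex"
  assumes f: "f \<in> test_functions" and g: "g \<in> test_functions"
  shows "partial_deriv i (\<lambda>x. a * f x + b * g x) =
    (\<lambda>x. a * partial_deriv i f x + b * partial_deriv i g x)"
  using partial_deriv_unique[OF test_functions_lincomb_has_derivative[OF assms]]
  by (auto simp: partial_deriv_def)

lemma test_functions_lincomb:
  fixes f g :: "real^'n::finite \<Rightarrow> complex"
  assumes f: "f \<in> test_functions" and g: "g \<in> test_functions"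
  shows "(\<lambda>x. a * f x + b * g x) \<in> test_functions"
proof (rule test_functions_coinduct[where
      F = "{\<lambda>x. a * f x + b * g x | f g. f \<in> test_functions \<and> g \<in> test_functions}"])
  fix h :: "real^'n \<Rightarrow> complex" and i
  assume "h \<in> {\<lambda>x. a * f x + b * g x | f g. f \<in> test_functions \<and> g \<in> test_functions}"
  then obtain f g where fg: "f \<in> test_functions" "g \<in> test_functions" "h = (\<lambda>x. a * f x + b * g x)"
    by auto
  show "h differentiable_on UNIV"
    using test_functions_lincomb_has_derivative[OF fg(1,2)]
    by (auto simp: fg(3) differentiable_on_def differentiable_def)
  show "partial_deriv i h \<in> {\<lambda>x. a * f x + b * g x | f g. f \<in> test_functions \<and> g \<in> test_functions}"
    using fg by (auto simp: partial_deriv_lincomb intro!: partial_deriv_test_functions)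
  show "h (x + v) = h x" if "v \<in> int_lattice" for x v
    by (simp add: fg(3) test_functions_periodic[OF fg(1) that] test_functions_periodic[OF fg(2) that])
qed (use f g in auto)

lemma test_functions_diff:
  "f \<in> test_functions \<Longrightarrow> g \<in> test_functions \<Longrightarrow> (\<lambda>x. f x - g x) \<in> test_functions"
  using test_functions_lincomb[of f g 1 "-1"] by simp

lemma test_functions_cnj:
  fixes f :: "real^'n::finite \<Rightarrow> complex"
  assumes "f \<in> test_functions"
  shows "(\<lambda>x. cnj (f x)) \<in> test_functions"
proof (rule test_functions_coinduct[where F = "{\<lambda>x. cnj (f x) | f. f \<in> test_functions}"])
  fix h :: "real^'n \<Rightarrow> complex" and i
  assume "h \<in> {\<lambda>x. cnj (f x) | f. f \<in> test_functions}"
  then obtain f where f: "f \<in> test_functions" "h = (\<lambda>x. cnj (f x))"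
    by auto
  have D: "(h has_derivative (\<lambda>v. cnj (frechet_derivative f (at x) v))) (at x)" for x
    unfolding f by (intro has_derivative_cnj test_functions_frechet f)
  then show "h differentiable_on UNIV"
    by (auto simp: differentiable_on_def differentiable_def)
  have "partial_deriv i h = (\<lambda>x. cnj (partial_deriv i f x))"
    using partial_deriv_unique[OF D] by (auto simp: partial_deriv_def)
  then show "partial_deriv i h \<in> {\<lambda>x. cnj (f x) | f. f \<in> test_functions}"
    using f by (auto intro!: partial_deriv_test_functions)
  show "h (x + v) = h x" if "v \<in> int_lattice" for x v
    by (simp add: f(2) test_functions_periodic[OF f(1) that])
qed (use assms in auto)

definition torus_character :: "real^'n::finite \<Rightarrow> real^'n \<Rightarrow> complex" where
  "torus_character k x = cis (2 * pi * (k \<bullet> x))"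

lemma int_lattice_inner: "k \<in> int_lattice \<Longrightarrow> v \<in> int_lattice \<Longrightarrow> k \<bullet> v \<in> \<int>"
  by (auto simp: int_lattice_def inner_vec_def intro!: Ints_sum Ints_mult)

lemma cis_2pi_int: "r \<in> \<int> \<Longrightarrow> cis (2 * pi * r) = 1"
  by (auto elim!: Ints_cases simp: cis_multiple_2pi)

lemma torus_character_test_functions:
  fixes k :: "real^'n::finite"
  assumes k: "k \<in> int_lattice"
  shows "(\<lambda>x. c * torus_character k x) \<in> test_functions"
proof (rule test_functions_coinduct[where F = "range (\<lambda>c x. c * torus_character k x)"])
  fix h :: "real^'n \<Rightarrow> complex" and i
  assume "h \<in> range (\<lambda>c x. c * torus_character k x)"
  then obtain c where h: "h = (\<lambda>x. c * torus_character k x)" by auto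
  have "((\<lambda>x::real^'n. exp (\<i> * of_real (2 * pi * (k \<bullet> x)))) has_derivative 
    (\<lambda>v. exp (\<i> * of_real (2 * pi * (k \<bullet> x))) * (\<i> * of_real (2 * pi * (k \<bullet> v))))) (at x)" for x
  proof -
    have "((\<lambda>x::real^'n. \<i> * of_real (2 * pi * (k \<bullet> x))) has_derivative
        (\<lambda>v. \<i> * of_real (2 * pi * (k \<bullet> v)))) (at x)"
      by (auto intro!: derivative_eq_intros)
    from has_derivative_compose[OF this, of exp] show ?thesis
      using DERIV_exp by (auto simp: has_field_derivative_def)
  qed
  from has_derivative_mult_right[OF this, of c]
  have D: "(h has_derivative (\<lambda>v. c * (torus_character k x * (\<i> * of_real (2 * pi * (k \<bullet> v)))))) (at x)" for x
    by (simp add: h torus_character_def cis_conv_exp)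
  then show "h differentiable_on UNIV"
    by (auto simp: differentiable_on_def differentiable_def)
  have "partial_deriv i h = (\<lambda>x. (c * (\<i> * of_real (2 * pi * (k $ i)))) * torus_character k x)"
    using partial_deriv_unique[OF D] by (auto simp: inner_axis)
  then show "partial_deriv i h \<in> range (\<lambda>c x. c * torus_character k x)"
    by blast
  show "h (x + v) = h x" if "v \<in> int_lattice" for x v
  proof -
    have "torus_character k (x + v) = torus_character k x * cis (2 * pi * (k \<bullet> v))"
      by (simp add: torus_character_def inner_add_right cis_mult ring_distribs)
    then show ?thesis by (simp add: h cis_2pi_int int_lattice_inner k that)
  qed
qed auto

section \<open>Seminorms and the topology of the test functions\<close>

lemma multi_deriv_test_functions:
  fixes f :: "real^'n::finite \<Rightarrow> complex"
  assumes "f \<in> test_functions"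
  shows "multi_deriv \<alpha> f \<in> test_functions"
proof -
  have pow: "(partial_deriv i ^^ m) g \<in> test_functions" if "g \<in> test_functions"
    for i m and g :: "real^'n \<Rightarrow> complex"
    using that by (induction m) (auto intro: partial_deriv_test_functions)
  have "foldr (\<lambda>i. partial_deriv i ^^ \<alpha> i) is f \<in> test_functions" for "is"
    by (induction "is") (auto simp: assms pow)
  then show ?thesis by (simp add: multi_deriv_def)
qed

text \<open>Iterated derivatives are taken in a fixed order, so an operator that commutes with each single
partial derivative commutes with all of them, without any appeal to symmetry of mixed derivatives.\<close>

lemma multi_deriv_commute:
  fixes f :: "real^'n::finite \<Rightarrow> complex"
  assumes closed: "\<And>g. g \<in> test_functions \<Longrightarrow> F g \<in> test_functions"
    and commute: "\<And>g i. g \<in> test_functions \<Longrightarrow> partial_deriv i (F g) = F (partial_deriv i g)"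
    and f: "f \<in> test_functions"
  shows "multi_deriv \<alpha> (F f) = F (multi_deriv \<alpha> f)"
proof -
  have pow: "(partial_deriv i ^^ m) (F g) = F ((partial_deriv i ^^ m) g) \<and>
      (partial_deriv i ^^ m) g \<in> test_functions" if "g \<in> test_functions"
    for i m and g :: "real^'n \<Rightarrow> complex"
    using that by (induction m) (auto intro: partial_deriv_test_functions simp: commute)
  have "foldr (\<lambda>i. partial_deriv i ^^ \<alpha> i) is (F f) = F (foldr (\<lambda>i. partial_deriv i ^^ \<alpha> i) is f) \<and>
      foldr (\<lambda>i. partial_deriv i ^^ \<alpha> i) is f \<in> test_functions" for "is"
    by (induction "is") (auto simp: f pow)
  then show ?thesis by (simp add: multi_deriv_def)
qed

lemma multi_deriv_lincomb:
  fixes f g :: "real^'n::finite \<Rightarrow> complex"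
  assumes f: "f \<in> test_functions" and g: "g \<in> test_functions"
  shows "multi_deriv \<alpha> (\<lambda>x. a * f x + b * g x) =
    (\<lambda>x. a * multi_deriv \<alpha> f x + b * multi_deriv \<alpha> g x)"
proof -
  have pow: "(partial_deriv i ^^ m) (\<lambda>x. a * p x + b * q x) =
        (\<lambda>x. a * (partial_deriv i ^^ m) p x + b * (partial_deriv i ^^ m) q x) \<and>
      (partial_deriv i ^^ m) p \<in> test_functions \<and> (partial_deriv i ^^ m) q \<in> test_functions"
    if "p \<in> test_functions" "q \<in> test_functions" for i m and p q :: "real^'n \<Rightarrow> complex"
    using that by (induction m) (auto intro: partial_deriv_test_functions simp: partial_deriv_lincomb)
  have "foldr (\<lambda>i. partial_deriv i ^^ \<alpha> i) is (\<lambda>x. a * f x + b * g x) =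
        (\<lambda>x. a * foldr (\<lambda>i. partial_deriv i ^^ \<alpha> i) is f x + b * foldr (\<lambda>i. partial_deriv i ^^ \<alpha> i) is g x) \<and>
      foldr (\<lambda>i. partial_deriv i ^^ \<alpha> i) is f \<in> test_functions \<and>
      foldr (\<lambda>i. partial_deriv i ^^ \<alpha> i) is g \<in> test_functions" for "is"
    by (induction "is") (auto simp: f g pow)
  then show ?thesis by (simp add: multi_deriv_def)
qed

lemma multi_deriv_diff:
  fixes f g :: "real^'n::finite \<Rightarrow> complex"
  assumes "f \<in> test_functions" and "g \<in> test_functions"
  shows "multi_deriv \<alpha> (\<lambda>x. f x - g x) = (\<lambda>x. multi_deriv \<alpha> f x - multi_deriv \<alpha> g x)"
  using multi_deriv_lincomb[OF assms, of \<alpha> 1 "-1"] by simp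

lemma multi_deriv_zero: "multi_deriv (\<lambda>_. 0) f = f"
proof -
  have "foldr (\<lambda>i. partial_deriv i ^^ 0) is f = f" for "is"
    by (induction "is") auto
  then show ?thesis by (simp add: multi_deriv_def)
qed

lemma finite_multi_indices: "finite {\<alpha> :: 'n::finite \<Rightarrow> nat. sum \<alpha> UNIV \<le> N}"
proof (rule finite_subset)
  show "{\<alpha> :: 'n \<Rightarrow> nat. sum \<alpha> UNIV \<le> N} \<subseteq> (\<Pi>\<^sub>E i\<in>UNIV. {..N})"
  proof
    fix \<alpha> :: "'n \<Rightarrow> nat" assume "\<alpha> \<in> {\<alpha>. sum \<alpha> UNIV \<le> N}"
    moreover have "\<alpha> i \<le> sum \<alpha> UNIV" for i by (rule member_le_sum) auto
    ultimately show "\<alpha> \<in> (\<Pi>\<^sub>E i\<in>UNIV. {..N})" by (auto intro: order_trans)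
  qed
qed (auto intro: finite_PiE)

lemma unit_cube_representative:
  fixes x :: "real^'n::finite"
  obtains y v where "y \<in> cbox 0 1" "v \<in> int_lattice" "x = y + v"
proof
  show "(\<chi> i. frac (x $ i)) \<in> cbox (0 :: real^'n) 1"
    by (auto simp: mem_box_cart frac_lt_1 less_imp_le)
  show "(\<chi> i. of_int \<lfloor>x $ i\<rfloor>) \<in> (int_lattice :: (real^'n) set)"
    by (simp add: int_lattice_def)
  show "x = (\<chi> i. frac (x $ i)) + (\<chi> i. of_int \<lfloor>x $ i\<rfloor>)"
    by (simp add: vec_eq_iff frac_def)
qed

lemma periodic_continuous_bounded:
  fixes f :: "real^'n::finite \<Rightarrow> complex"
  assumes f: "f \<in> periodic_continuous"
  obtains B where "\<And>x. cmod (f x) \<le> B"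
proof -
  have "compact (f ` cbox 0 1)"
    using f by (intro compact_continuous_image compact_cbox)
      (auto simp: periodic_continuous_def intro: continuous_on_subset)
  then obtain B where B: "\<And>y. y \<in> f ` cbox 0 1 \<Longrightarrow> cmod y \<le> B"
    using compact_imp_bounded bounded_iff by metis
  have "cmod (f x) \<le> B" for x
  proof -
    obtain y v where "y \<in> cbox 0 1" "v \<in> int_lattice" "x = y + v"
      by (rule unit_cube_representative)
    then show ?thesis using B f by (auto simp: periodic_continuous_def)
  qed
  then show ?thesis by (rule that)
qed

lemma cmod_multi_deriv_le_seminorm:
  fixes f :: "real^'n::finite \<Rightarrow> complex"
  assumes f: "f \<in> test_functions" and \<alpha>: "sum \<alpha> UNIV \<le> N"
  shows "cmod (multi_deriv \<alpha> f x) \<le> test_seminorm N f"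
proof -
  obtain B where "\<And>x. cmod (multi_deriv \<alpha> f x) \<le> B"
    using periodic_continuous_bounded[OF
        test_functions_periodic_continuous[OF multi_deriv_test_functions[OF f]]] by blast
  then have "bdd_above (range (\<lambda>x. cmod (multi_deriv \<alpha> f x)))"
    by (auto intro!: bdd_aboveI[where M = B])
  then have "cmod (multi_deriv \<alpha> f x) \<le> (SUP x. cmod (multi_deriv \<alpha> f x))"
    by (intro cSUP_upper) auto
  also have "\<dots> \<le> test_seminorm N f"
    unfolding test_seminorm_def using \<alpha>
    by (intro cSUP_upper bdd_above_finite finite_imageI finite_multi_indices) auto
  finally show ?thesis .
qed

text \<open>Together with \<open>cmod_multi_deriv_le_seminorm\<close> this makes the seminorm the least common bound of
the derivatives of order at most \<open>N\<close>, and no supremum has to be handled again.\<close>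

lemma test_seminorm_least:
  fixes f :: "real^'n::finite \<Rightarrow> complex"
  assumes "\<And>\<alpha> x. sum \<alpha> UNIV \<le> N \<Longrightarrow> cmod (multi_deriv \<alpha> f x) \<le> C"
  shows "test_seminorm N f \<le> C"
proof -
  have "(\<lambda>_. 0) \<in> {\<alpha> :: 'n \<Rightarrow> nat. sum \<alpha> UNIV \<le> N}" by simp
  then have "{\<alpha> :: 'n \<Rightarrow> nat. sum \<alpha> UNIV \<le> N} \<noteq> {}" by blast
  then show ?thesis
    unfolding test_seminorm_def using assms by (intro cSUP_least) auto
qed

lemma cmod_le_seminorm: "f \<in> test_functions \<Longrightarrow> cmod (f x) \<le> test_seminorm N f"
  using cmod_multi_deriv_le_seminorm[of f "\<lambda>_. 0" N x] by (simp add: multi_deriv_zero)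

lemma test_seminorm_mono:
  "f \<in> test_functions \<Longrightarrow> N \<le> M \<Longrightarrow> test_seminorm N f \<le> test_seminorm M f"
  by (intro test_seminorm_least cmod_multi_deriv_le_seminorm) auto

lemma test_seminorm_triangle:
  assumes "f \<in> test_functions" "g \<in> test_functions" "h \<in> test_functions"
  shows "test_seminorm N (\<lambda>x. f x - h x) \<le>
    test_seminorm N (\<lambda>x. f x - g x) + test_seminorm N (\<lambda>x. g x - h x)"
proof (rule test_seminorm_least)
  fix \<alpha> :: "'a \<Rightarrow> nat" and x assume "sum \<alpha> UNIV \<le> N"
  then have "cmod (multi_deriv \<alpha> f x - multi_deriv \<alpha> g x) \<le> test_seminorm N (\<lambda>x. f x - g x)"
    and "cmod (multi_deriv \<alpha> g x - multi_deriv \<alpha> h x) \<le> test_seminorm N (\<lambda>x. g x - h x)"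
    using cmod_multi_deriv_le_seminorm[OF test_functions_diff[OF assms(1,2)], of \<alpha> N x]
      cmod_multi_deriv_le_seminorm[OF test_functions_diff[OF assms(2,3)], of \<alpha> N x]
    by (simp_all add: multi_deriv_diff assms)
  then have "cmod ((multi_deriv \<alpha> f x - multi_deriv \<alpha> g x) + (multi_deriv \<alpha> g x - multi_deriv \<alpha> h x))
      \<le> test_seminorm N (\<lambda>x. f x - g x) + test_seminorm N (\<lambda>x. g x - h x)"
    by (rule norm_triangle_mono)
  then show "cmod (multi_deriv \<alpha> (\<lambda>x. f x - h x) x)
      \<le> test_seminorm N (\<lambda>x. f x - g x) + test_seminorm N (\<lambda>x. g x - h x)"
    using assms by (simp add: multi_deriv_diff)
qed

lemma test_seminorm_diff_self:
  assumes "f \<in> test_functions"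
  shows "test_seminorm N (\<lambda>x. f x - f x) \<le> 0"
  by (rule test_seminorm_least) (simp only: multi_deriv_diff[OF assms assms], simp)

text \<open>The sets that generate the topology are balls, and they form a base: the seminorms increase with
the order, so the intersection of two balls around a point contains a ball for the larger order.\<close>

lemma openin_test_topology_iff:
  fixes U :: "(real^'n::finite \<Rightarrow> complex) set"
  shows "openin test_topology U \<longleftrightarrow> U \<subseteq> test_functions \<and>
    (\<forall>g\<in>U. \<exists>N e. 0 < e \<and> {h \<in> test_functions. test_seminorm N (\<lambda>x. h x - g x) < e} \<subseteq> U)"
    (is "_ \<longleftrightarrow> _ \<and> (\<forall>g\<in>U. \<exists>N e. _ \<and> ?ball N g e \<subseteq> U)")
proof
  assume "openin test_topology U"
  then have "generate_topology_on {?ball N f e | f N e. f \<in> test_functions \<and> 0 < e} U"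
    unfolding test_topology_def by (rule openin_topology_generated_by)
  then show "U \<subseteq> test_functions \<and> (\<forall>g\<in>U. \<exists>N e. 0 < e \<and> ?ball N g e \<subseteq> U)"
  proof induction
    case (Int a b)
    have "\<exists>N e. 0 < e \<and> ?ball N g e \<subseteq> a \<inter> b" if g: "g \<in> a \<inter> b" for g
    proof -
      obtain N e where a: "0 < e" "?ball N g e \<subseteq> a" using Int g by auto
      obtain M e' where b: "0 < e'" "?ball M g e' \<subseteq> b" using Int g by auto
      have "g \<in> test_functions" using g Int by auto
      then have "test_seminorm N (\<lambda>x. h x - g x) \<le> test_seminorm (max N M) (\<lambda>x. h x - g x)"
        "test_seminorm M (\<lambda>x. h x - g x) \<le> test_seminorm (max N M) (\<lambda>x. h x - g x)"
        if "h \<in> test_functions" for h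
        using that by (auto intro!: test_seminorm_mono test_functions_diff)
      then have "?ball (max N M) g (min e e') \<subseteq> ?ball N g e \<inter> ?ball M g e'"
        by (auto intro: le_less_trans)
      then show ?thesis using a b by (intro exI[of _ "max N M"] exI[of _ "min e e'"]) auto
    qed
    then show ?case using Int by auto
  next
    case (UN K)
    have "\<exists>N e. 0 < e \<and> ?ball N g e \<subseteq> \<Union>K" if g: "g \<in> \<Union>K" for g
    proof -
      from g obtain k where "k \<in> K" "g \<in> k" by auto
      then obtain N e where "0 < e" "?ball N g e \<subseteq> k" using UN by blast
      then show ?thesis using \<open>k \<in> K\<close> by blast
    qed
    moreover have "\<Union>K \<subseteq> test_functions" using UN by blast
    ultimately show ?case by blast
  next
    case (Basis s)
    then obtain f N e where s: "s = ?ball N f e" "f \<in> test_functions" "0 < e" by auto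
    have "\<exists>N e. 0 < e \<and> ?ball N g e \<subseteq> s" if g: "g \<in> s" for g
    proof -
      let ?r = "e - test_seminorm N (\<lambda>x. g x - f x)"
      have "test_seminorm N (\<lambda>x. h x - f x) < e"
        if "h \<in> test_functions" "test_seminorm N (\<lambda>x. h x - g x) < ?r" for h
        using test_seminorm_triangle[of h g f N] that s g by auto
      then have "?ball N g ?r \<subseteq> s" by (auto simp: s)
      moreover have "0 < ?r" using g s by simp
      ultimately show ?thesis by blast
    qed
    then show ?case using s by auto
  qed auto
next
  assume U: "U \<subseteq> test_functions \<and> (\<forall>g\<in>U. \<exists>N e. 0 < e \<and> ?ball N g e \<subseteq> U)"
  show "openin test_topology U"
  proof (subst openin_subopen, intro ballI)
    fix g assume g: "g \<in> U"
    then obtain N e where e: "0 < e" "?ball N g e \<subseteq> U" using U by blast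
    have "openin test_topology (?ball N g e)"
      unfolding test_topology_def using g U e by (intro topology_generated_by_Basis) blast
    moreover have "g \<in> ?ball N g e"
      using g U e test_seminorm_diff_self[of g N] by (auto simp del: cancel_comm_monoid_add_class.diff_cancel intro: le_less_trans)
    ultimately show "\<exists>T. openin test_topology T \<and> g \<in> T \<and> T \<subseteq> U" using e by blast
  qed
qed

lemma topspace_test_topology: "topspace test_topology = test_functions"
proof
  show "topspace test_topology \<subseteq> test_functions"
    by (rule conjunct1[OF iffD1[OF openin_test_topology_iff openin_topspace]])
  have "openin test_topology (test_functions :: (real^'a \<Rightarrow> complex) set)"
    unfolding openin_test_topology_iff using zero_less_one by blast
  then show "(test_functions :: (real^'a \<Rightarrow> complex) set) \<subseteq> topspace test_topology"
    by (rule openin_subset)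
qed

lemma continuous_map_test_topology_contraction:
  fixes F :: "(real^'n::finite \<Rightarrow> complex) \<Rightarrow> real^'m::finite \<Rightarrow> complex"
  assumes F: "\<And>f. f \<in> test_functions \<Longrightarrow> F f \<in> test_functions"
    and contraction: "\<And>N f g. f \<in> test_functions \<Longrightarrow> g \<in> test_functions \<Longrightarrow>
      test_seminorm N (\<lambda>x. F f x - F g x) \<le> test_seminorm N (\<lambda>x. f x - g x)"
  shows "continuous_map test_topology test_topology F"
  unfolding continuous_map_def topspace_test_topology
proof (intro conjI allI impI)
  fix U :: "(real^'m \<Rightarrow> complex) set" assume U: "openin test_topology U"
  show "openin test_topology {f \<in> test_functions. F f \<in> U}"
    unfolding openin_test_topology_iff
  proof (intro conjI ballI)
    fix f assume f: "f \<in> {f \<in> test_functions. F f \<in> U}"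
    then obtain N e where "0 < e"
      "{h \<in> test_functions. test_seminorm N (\<lambda>x. h x - F f x) < e} \<subseteq> U"
      using U unfolding openin_test_topology_iff by blast
    moreover have "test_seminorm N (\<lambda>x. F h x - F f x) < e"
      if "h \<in> test_functions" "test_seminorm N (\<lambda>x. h x - f x) < e" for h
      using contraction[of h f N] that f by auto
    ultimately show "\<exists>N e. 0 < e \<and>
      {h \<in> test_functions. test_seminorm N (\<lambda>x. h x - f x) < e} \<subseteq> {f \<in> test_functions. F f \<in> U}"
      using F by (intro exI[of _ N] exI[of _ e]) blast
  qed auto
qed (use F in auto)

lemma continuous_map_test_topology_functional:
  fixes u :: "(real^'n::finite \<Rightarrow> complex) \<Rightarrow> complex"
  assumes bound: "\<And>f g. f \<in> test_functions \<Longrightarrow> g \<in> test_functions \<Longrightarrow>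
      cmod (u f - u g) \<le> C * test_seminorm N (\<lambda>x. f x - g x)"
  shows "continuous_map test_topology euclidean u"
  unfolding continuous_map_def topspace_test_topology
proof (intro conjI allI impI)
  fix U :: "complex set" assume "openin euclidean U"
  then have U: "open U" by simp
  show "openin test_topology {f \<in> test_functions. u f \<in> U}"
    unfolding openin_test_topology_iff
  proof (intro conjI ballI)
    fix f assume f: "f \<in> {f \<in> test_functions. u f \<in> U}"
    then obtain e where e: "0 < e" "ball (u f) e \<subseteq> U"
      using U by (auto simp: open_contains_ball)
    have "u h \<in> U"
      if h: "h \<in> test_functions" "test_seminorm N (\<lambda>x. h x - f x) < e / (\<bar>C\<bar> + 1)" for h
    proof -
      have "0 \<le> test_seminorm N (\<lambda>x. h x - f x)"
        using cmod_le_seminorm[OF test_functions_diff, of h f 0 N] h f norm_ge_zero order_trans by blast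
      then have "cmod (u h - u f) \<le> (\<bar>C\<bar> + 1) * test_seminorm N (\<lambda>x. h x - f x)"
        using bound[of h f] h f by (intro order_trans[OF bound] mult_right_mono) auto
      also have "\<dots> < e" using h(2) by (simp add: field_simps)
      finally show ?thesis using e by (auto simp: dist_norm norm_minus_commute)
    qed
    then show "\<exists>N e. 0 < e \<and>
      {h \<in> test_functions. test_seminorm N (\<lambda>x. h x - f x) < e} \<subseteq> {f \<in> test_functions. u f \<in> U}"
      using e by (intro exI[of _ N] exI[of _ "e / (\<bar>C\<bar> + 1)"]) auto
  qed auto
qed auto

lemma continuous_functional_tendsto:
  fixes u :: "(real^'n::finite \<Rightarrow> complex) \<Rightarrow> complex"
  assumes u: "continuous_map test_topology euclidean u"
    and f: "f \<in> test_functions" "\<And>m. g m \<in> test_functions"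
    and conv: "\<And>N e. 0 < e \<Longrightarrow> \<forall>\<^sub>F m in sequentially. test_seminorm N (\<lambda>x. g m x - f x) < e"
  shows "(\<lambda>m. u (g m)) \<longlonglongrightarrow> u f"
proof (rule topological_tendstoI)
  fix U assume "open U" "u f \<in> U"
  then have "openin test_topology {h \<in> test_functions. u h \<in> U}"
    using u unfolding continuous_map_def topspace_test_topology by simp
  then obtain N e where e: "0 < e"
    "{h \<in> test_functions. test_seminorm N (\<lambda>x. h x - f x) < e} \<subseteq> {h \<in> test_functions. u h \<in> U}"
    using f \<open>u f \<in> U\<close> unfolding openin_test_topology_iff by blast
  show "\<forall>\<^sub>F m in sequentially. u (g m) \<in> U"
    using conv[OF e(1), of N] by eventually_elim (use e f in auto)
qed

section \<open>The Radon transform as an iterated segment average\<close>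

definition plane_integral ::
    "(real^'n::finite) set \<Rightarrow> (real^'n \<Rightarrow> complex) \<Rightarrow> real^'n \<Rightarrow> complex" where
  "plane_integral A f x =
     (LINT t:(A \<rightarrow>\<^sub>E {0..1})|(\<Pi>\<^sub>M v\<in>A. lborel). f (x + (\<Sum>v\<in>A. t v *\<^sub>R v)))"

abbreviation segment_average :: "real^'n::finite \<Rightarrow> (real^'n \<Rightarrow> complex) \<Rightarrow> real^'n \<Rightarrow> complex" where
  "segment_average \<equiv> line_average (\<lambda>_. 1)"

lemma radon_eq_plane_integral: "A \<in> direction_sets d \<Longrightarrow> radon d f A = plane_integral A f"
  by (simp add: radon_def plane_integral_def[abs_def])

lemma line_average_periodic_continuous:
  fixes f :: "real^'n::finite \<Rightarrow> complex"
  assumes k: "continuous_on {0..1} k" and f: "f \<in> periodic_continuous"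
  shows "line_average k v f \<in> periodic_continuous"
proof -
  have cont: "continuous_on UNIV f" using f by (simp add: periodic_continuous_def)
  have "continuous_on UNIV (\<lambda>x. integral (cbox 0 1) (\<lambda>t. k t * f (x + t *\<^sub>R v)))"
  proof (rule integral_continuous_on_param)
    have "continuous_on (UNIV \<times> cbox 0 1) (\<lambda>p. k (snd p) * f (fst p + snd p *\<^sub>R v))"
      by (intro continuous_intros continuous_on_compose2[OF k] continuous_on_compose2[OF cont]) auto
    then show "continuous_on (UNIV \<times> cbox 0 1) (\<lambda>(x, t). k t * f (x + t *\<^sub>R v))"
      by (simp add: split_beta)
  qed
  moreover have "f (x + w + t *\<^sub>R v) = f (x + t *\<^sub>R v)" if "w \<in> int_lattice" for x w t
    using periodic_continuous_shift[OF f that, of "x + t *\<^sub>R v"] by (simp add: add_ac)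
  ultimately show ?thesis
    by (simp add: periodic_continuous_def line_average_def[abs_def])
qed

lemma plane_integral_integrable:
  fixes f :: "real^'n::finite \<Rightarrow> complex"
  assumes A: "finite A" and f: "f \<in> periodic_continuous"
  shows "integrable (\<Pi>\<^sub>M v\<in>A. lborel)
    (\<lambda>t. indicator (A \<rightarrow>\<^sub>E {0..1}) t *\<^sub>R f (x + (\<Sum>v\<in>A. t v *\<^sub>R v)))"
proof -
  interpret product_sigma_finite "\<lambda>_ :: real^'n. lborel :: real measure" ..
  obtain B where B: "\<And>x. cmod (f x) \<le> B" using periodic_continuous_bounded[OF f] by blast
  have [measurable]: "f \<in> borel_measurable borel"
    using f by (intro borel_measurable_continuous_onI) (simp add: periodic_continuous_def)
  show ?thesis
  proof (rule integrableI_bounded_set_indicator)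
    show "(A \<rightarrow>\<^sub>E {0..1 :: real}) \<in> sets (\<Pi>\<^sub>M v\<in>A. lborel)"
      using A by (intro sets_PiM_I_finite) auto
    show "emeasure (\<Pi>\<^sub>M v\<in>A. lborel) (A \<rightarrow>\<^sub>E {0..1 :: real}) < \<infinity>"
      using A by (subst emeasure_PiM) auto
    show "(\<lambda>t. f (x + (\<Sum>v\<in>A. t v *\<^sub>R v))) \<in> borel_measurable (\<Pi>\<^sub>M v\<in>A. lborel)"
      by measurable
    show "AE t in \<Pi>\<^sub>M v\<in>A. lborel. t \<in> (A \<rightarrow>\<^sub>E {0..1 :: real}) \<longrightarrow> cmod (f (x + (\<Sum>v\<in>A. t v *\<^sub>R v))) \<le> B"
      by (simp add: B)
  qed
qed

lemma plane_integral_empty: "plane_integral {} (f :: real^'n::finite \<Rightarrow> complex) = f"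
proof -
  have "indicator (({} :: (real^'n::finite) set) \<rightarrow>\<^sub>E {0..1 :: real}) (\<lambda>_. undefined) = (1 :: real)"
    by (auto simp: indicator_def)
  then show ?thesis
    by (simp add: plane_integral_def[abs_def] set_lebesgue_integral_def PiM_empty
        lebesgue_integral_count_space_finite)
qed

text \<open>Fubini in the coordinate of the cube that belongs to \<open>v\<close>. This turns every statement about the
integral over a cube of arbitrary dimension into an induction over the directions.\<close>

lemma plane_integral_insert:
  fixes f :: "real^'n::finite \<Rightarrow> complex"
  assumes A: "finite A" "v \<notin> A" and f: "f \<in> periodic_continuous"
  shows "plane_integral (insert v A) f = plane_integral A (segment_average v f)"
proof
  fix x
  interpret product_sigma_finite "\<lambda>_ :: real^'n. lborel :: real measure" ..
  have inner: "(\<integral>y. indicator (insert v A \<rightarrow>\<^sub>E {0..1}) (t(v := y)) *\<^sub>R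
          f (x + (\<Sum>w\<in>insert v A. (t(v := y)) w *\<^sub>R w)) \<partial>lborel) =
      indicator (A \<rightarrow>\<^sub>E {0..1}) t *\<^sub>R segment_average v f (x + (\<Sum>w\<in>A. t w *\<^sub>R w))"
    if t: "t \<in> space (\<Pi>\<^sub>M w\<in>A. lborel)" for t
  proof -
    have ext: "t \<in> extensional A" using t by (auto simp: space_PiM PiE_def)
    have ind: "indicator (insert v A \<rightarrow>\<^sub>E {0..1}) (t(v := y)) =
        indicator (A \<rightarrow>\<^sub>E {0..1}) t * (indicator {0..1} y :: real)" for y
      using A(2) ext by (auto simp: indicator_def PiE_def Pi_def extensional_def)
    have sum: "(\<Sum>w\<in>insert v A. (t(v := y)) w *\<^sub>R w) = y *\<^sub>R v + (\<Sum>w\<in>A. t w *\<^sub>R w)" for y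
      using A by (simp add: sum.insert) (intro sum.cong, auto)
    define p where "p = x + (\<Sum>w\<in>A. t w *\<^sub>R w)"
    have "set_integrable lborel {0..1} (\<lambda>y. f (p + y *\<^sub>R v))"
      using line_average_integrand_continuous[of "\<lambda>_. 1" f p v] f
      by (intro borel_integrable_atLeastAtMost') (simp_all add: periodic_continuous_def)
    then have "(LINT y:{0..1}|lborel. f (p + y *\<^sub>R v)) = segment_average v f p"
      by (simp add: set_borel_integral_eq_integral line_average_def)
    then have "(\<integral>y. indicator {0..1} y *\<^sub>R f (p + y *\<^sub>R v) \<partial>lborel) = segment_average v f p"
      by (simp add: set_lebesgue_integral_def)
    moreover have shift: "x + (y *\<^sub>R v + (\<Sum>w\<in>A. t w *\<^sub>R w)) = p + y *\<^sub>R v" for y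
      by (simp add: p_def)
    ultimately show ?thesis
      unfolding ind sum shift p_def[symmetric]
      by (simp add: scaleR_scaleR[symmetric] del: scaleR_scaleR)
  qed
  show "plane_integral (insert v A) f x = plane_integral A (segment_average v f) x"
    unfolding plane_integral_def set_lebesgue_integral_def
    by (subst product_integral_insert[OF A plane_integral_integrable])
      (use A f inner in \<open>auto intro!: Bochner_Integration.integral_cong\<close>)
qed

lemma plane_integral_test_functions:
  fixes f :: "real^'n::finite \<Rightarrow> complex"
  assumes "finite A" "f \<in> test_functions"
  shows "plane_integral A f \<in> test_functions"
  using assms
proof (induction A arbitrary: f)
  case (insert v A)
  then show ?case
    using line_average_test_functions[of "\<lambda>_. 1" f v]
    by (simp add: plane_integral_insert test_functions_periodic_continuous)
qed (simp add: plane_integral_empty)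

lemma plane_integral_periodic_continuous:
  fixes f :: "real^'n::finite \<Rightarrow> complex"
  assumes "finite A" "f \<in> periodic_continuous"
  shows "plane_integral A f \<in> periodic_continuous"
  using assms
proof (induction A arbitrary: f)
  case (insert v A)
  then show ?case
    using line_average_periodic_continuous[of "\<lambda>_. 1" f v]
    by (simp add: plane_integral_insert)
qed (simp add: plane_integral_empty)

lemma partial_deriv_plane_integral:
  fixes f :: "real^'n::finite \<Rightarrow> complex"
  assumes "finite A" "f \<in> test_functions"
  shows "partial_deriv i (plane_integral A f) = plane_integral A (partial_deriv i f)"
  using assms
proof (induction A arbitrary: f)
  case (insert v A)
  then show ?case
    using line_average_test_functions[of "\<lambda>_. 1" f v] partial_deriv_line_average[of "\<lambda>_. 1" f i v]
    by (simp add: plane_integral_insert test_functions_periodic_continuous partial_deriv_test_functions)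
qed (simp add: plane_integral_empty)

lemma line_average_bound:
  fixes f :: "real^'n::finite \<Rightarrow> complex"
  assumes k: "continuous_on {0..1} k" and f: "f \<in> periodic_continuous"
    and bound: "\<And>t. t \<in> {0..1} \<Longrightarrow> cmod (k t * f (x + t *\<^sub>R v)) \<le> C"
  shows "cmod (line_average k v f x) \<le> C"
  using integral_bound[of 0 1 "\<lambda>t. k t * f (x + t *\<^sub>R v)" C]
    line_average_integrand_continuous[OF k, of f x v] f bound
  by (simp add: line_average_def periodic_continuous_def)

lemma plane_integral_bound:
  fixes f :: "real^'n::finite \<Rightarrow> complex"
  assumes "finite A" "f \<in> periodic_continuous" "\<And>x. cmod (f x) \<le> C"
  shows "cmod (plane_integral A f x) \<le> C"
  using assms
proof (induction A arbitrary: f x)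
  case (insert v A)
  have "cmod (segment_average v f y) \<le> C" for y
    using insert.prems by (intro line_average_bound) auto
  then show ?case
    using insert line_average_periodic_continuous[of "\<lambda>_. 1" f v]
    by (simp add: plane_integral_insert)
qed (simp add: plane_integral_empty)

lemma line_average_lincomb:
  fixes f g :: "real^'n::finite \<Rightarrow> complex"
  assumes k: "continuous_on {0..1} k" and "f \<in> periodic_continuous" "g \<in> periodic_continuous"
  shows "line_average k v (\<lambda>x. a * f x + b * g x) =
    (\<lambda>x. a * line_average k v f x + b * line_average k v g x)"
proof
  fix x
  have "(\<lambda>t. k t * f (x + t *\<^sub>R v)) integrable_on {0..1}"
    and "(\<lambda>t. k t * g (x + t *\<^sub>R v)) integrable_on {0..1}"
    using line_average_integrable[OF k] assms by (auto simp: periodic_continuous_def)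
  then have "integral {0..1} (\<lambda>t. a * (k t * f (x + t *\<^sub>R v)) + b * (k t * g (x + t *\<^sub>R v))) =
      a * integral {0..1} (\<lambda>t. k t * f (x + t *\<^sub>R v)) + b * integral {0..1} (\<lambda>t. k t * g (x + t *\<^sub>R v))"
    by (subst Henstock_Kurzweil_Integration.integral_add) (auto intro: integrable_on_mult_right)
  then show "line_average k v (\<lambda>x. a * f x + b * g x) x =
      a * line_average k v f x + b * line_average k v g x"
    by (simp add: line_average_def algebra_simps)
qed

lemma plane_integral_lincomb:
  fixes f g :: "real^'n::finite \<Rightarrow> complex"
  assumes "finite A" "f \<in> periodic_continuous" "g \<in> periodic_continuous"
  shows "plane_integral A (\<lambda>x. a * f x + b * g x) =
    (\<lambda>x. a * plane_integral A f x + b * plane_integral A g x)"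
  using assms
proof (induction A arbitrary: f g)
  case (insert v A)
  have "(\<lambda>x. a * f x + b * g x) \<in> periodic_continuous"
    using insert.prems by (auto simp: periodic_continuous_def intro!: continuous_intros)
  then show ?case
    using insert line_average_periodic_continuous[of "\<lambda>_. 1" _ v] line_average_lincomb[of "\<lambda>_. 1" f g v a b]
    by (simp add: plane_integral_insert)
qed (simp add: plane_integral_empty)

lemma segment_average_commute:
  fixes f :: "real^'n::finite \<Rightarrow> complex"
  assumes f: "f \<in> periodic_continuous"
  shows "segment_average v (segment_average w f) = segment_average w (segment_average v f)"
proof
  fix x
  have cont: "continuous_on UNIV f" using f by (simp add: periodic_continuous_def)
  have "continuous_on (cbox (0, 0) (1, 1)) (\<lambda>p. f (x + fst p *\<^sub>R v + snd p *\<^sub>R w))"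
    by (intro continuous_intros continuous_on_compose2[OF cont]) auto
  then have "continuous_on (cbox (0, 0) (1, 1)) (\<lambda>(t, s). f (x + t *\<^sub>R v + s *\<^sub>R w))"
    by (simp add: split_beta)
  from integral_swap_continuous[OF this]
  show "segment_average v (segment_average w f) x = segment_average w (segment_average v f) x"
    by (simp add: line_average_def add_ac)
qed

lemma plane_integral_segment_average_commute:
  fixes f :: "real^'n::finite \<Rightarrow> complex"
  assumes "finite A" "f \<in> periodic_continuous"
  shows "segment_average v (plane_integral A f) = plane_integral A (segment_average v f)"
  using assms
proof (induction A arbitrary: f)
  case (insert w A)
  then show ?case
    using line_average_periodic_continuous[of "\<lambda>_. 1" f]
    by (simp add: plane_integral_insert segment_average_commute[of f v w])
qed (simp add: plane_integral_empty)

section \<open>Translation invariance on the torus and symmetry of the transform\<close>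

lemma integral_period_shift:
  fixes \<phi> :: "real \<Rightarrow> complex"
  assumes cont: "continuous_on UNIV \<phi>" and period: "\<And>t. \<phi> (t + 1) = \<phi> t"
  shows "integral {0..1} (\<lambda>t. \<phi> (t + s)) = integral {0..1} \<phi>"
proof -
  \<comment> \<open>The period is \<open>1\<close>, so \<open>s\<close> may be reduced to its fractional part \<open>r\<close>; then \<open>[r, 1 + r]\<close> is
    cut at \<open>1\<close> and the second piece is moved back by one period.\<close>
  define r where "r = frac s"
  have r: "0 \<le> r" "r \<le> 1" by (auto simp: r_def frac_lt_1 less_imp_le)
  have nat: "\<phi> (t + of_nat m) = \<phi> t" for t m
  proof (induction m)
    case (Suc m)
    then show ?case using period[of "t + of_nat m"] by (simp add: add_ac)
  qed simp
  have int: "\<phi> (t + of_int m) = \<phi> t" for t m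
  proof (cases "m \<ge> 0")
    case True
    then show ?thesis using nat[of t "nat m"] by simp
  next
    case False
    then show ?thesis using nat[of "t + of_int m" "nat (- m)"] by simp
  qed
  have "\<phi> (t + s) = \<phi> (t + r)" for t
    using int[of "t + r" "\<lfloor>s\<rfloor>"] by (simp add: r_def frac_def)
  then have "integral {0..1} (\<lambda>t. \<phi> (t + s)) = integral {r - r..(1 + r) - r} (\<lambda>t. \<phi> (t + r))"
    by simp
  also have "\<dots> = integral {r..1 + r} \<phi>"
    by (rule integral_shift_real_ivl)
  also have "\<dots> = integral {r..1} \<phi> + integral {1..1 + r} \<phi>"
    using r by (intro Henstock_Kurzweil_Integration.integral_combine[symmetric]
        integrable_continuous_real continuous_on_subset[OF cont]) auto
  also have "integral {1..1 + r} \<phi> = integral {0..r} \<phi>"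
    using integral_shift_real_ivl[of 1 1 "1 + r" \<phi>] by (simp add: period)
  also have "integral {r..1} \<phi> + integral {0..r} \<phi> = integral {0..1} \<phi>"
    using r by (subst add.commute, intro Henstock_Kurzweil_Integration.integral_combine
        integrable_continuous_real continuous_on_subset[OF cont]) auto
  finally show ?thesis .
qed

lemma segment_average_shift:
  fixes f :: "real^'n::finite \<Rightarrow> complex"
  assumes f: "f \<in> periodic_continuous" and v: "v \<in> int_lattice"
  shows "segment_average v f (x + s *\<^sub>R v) = segment_average v f x"
proof -
  have cont: "continuous_on UNIV f" using f by (simp add: periodic_continuous_def)
  have per: "f (x + (t + 1) *\<^sub>R v) = f (x + t *\<^sub>R v)" for t
    using periodic_continuous_shift[OF f v, of "x + t *\<^sub>R v"] by (simp add: algebra_simps)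
  have "integral {0..1} (\<lambda>t. (\<lambda>t. f (x + t *\<^sub>R v)) (t + s)) = integral {0..1} (\<lambda>t. f (x + t *\<^sub>R v))"
    by (rule integral_period_shift) (auto intro!: continuous_on_compose2[OF cont] continuous_intros per)
  then show ?thesis by (simp add: line_average_def algebra_simps)
qed

lemma segment_average_reflect:
  fixes f :: "real^'n::finite \<Rightarrow> complex"
  assumes f: "f \<in> periodic_continuous" and v: "v \<in> int_lattice"
  shows "segment_average (- v) f = segment_average v f"
proof
  fix x
  have "segment_average (- v) f x = integral {- 0..- (- 1)} (\<lambda>t. f (x + (- t) *\<^sub>R v))"
    by (simp add: line_average_def)
  also have "\<dots> = integral {- 1..0} (\<lambda>t. f (x + t *\<^sub>R v))"
    by (rule Henstock_Kurzweil_Integration.integral_reflect_real)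
  also have "\<dots> = integral {- 1 - (- 1)..0 - (- 1)} (\<lambda>t. f (x + (t + (- 1)) *\<^sub>R v))"
    by (rule integral_shift_real_ivl[symmetric])
  also have "\<dots> = segment_average v f (x + (- 1) *\<^sub>R v)"
    by (simp add: line_average_def algebra_simps)
  also have "\<dots> = segment_average v f x"
    by (rule segment_average_shift[OF f v])
  finally show "segment_average (- v) f x = segment_average v f x" .
qed

text \<open>The averages over different directions commute, so the one over \<open>v\<close> can be taken last, where
translation by a multiple of \<open>v\<close> only shifts the integral over a period.\<close>

lemma plane_integral_shift:
  fixes f :: "real^'n::finite \<Rightarrow> complex"
  assumes A: "finite A" "A \<subseteq> int_lattice" "v \<in> A" and f: "f \<in> periodic_continuous"
  shows "plane_integral A f (x + s *\<^sub>R v) = plane_integral A f x"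
proof -
  have "A = insert v (A - {v})" using A by auto
  moreover have "finite (A - {v})" "v \<notin> A - {v}" using A by auto
  ultimately have eq: "plane_integral A f = segment_average v (plane_integral (A - {v}) f)"
    using plane_integral_insert[of "A - {v}" v f]
      plane_integral_segment_average_commute[of "A - {v}" f v] f by simp
  show ?thesis
    unfolding eq using A f
    by (intro segment_average_shift plane_integral_periodic_continuous) auto
qed

text \<open>Lebesgue measure on \<open>\<real>\<^sup>n\<close> is the image of the product measure under the coordinate map, so the
integral over the unit cube is itself an iterated segment average, in the coordinate directions.
Translation invariance of the integral over the torus is then inherited from
\<open>plane_integral_shift\<close>.\<close>

lemma cube_integral_eq_plane_integral:
  fixes f :: "real^'n::finite \<Rightarrow> complex"
  assumes f: "f \<in> periodic_continuous"
  shows "integral (cbox 0 1) (\<lambda>x. f (a + x)) = plane_integral Basis f a"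
proof -
  have cont: "continuous_on UNIV f" using f by (simp add: periodic_continuous_def)
  have "set_integrable lborel (cbox 0 1) (\<lambda>x. f (a + x))"
    unfolding set_integrable_def
    by (intro borel_integrable_compact continuous_on_compose2[OF cont] continuous_intros) auto
  then have "integral (cbox 0 1) (\<lambda>x. f (a + x)) = (LINT x:cbox 0 1|lborel. f (a + x))"
    by (rule set_borel_integral_eq_integral(2)[symmetric])
  also have "\<dots> = (\<integral>t. indicator (cbox 0 1) (\<Sum>b\<in>Basis. t b *\<^sub>R b) *\<^sub>R f (a + (\<Sum>b\<in>Basis. t b *\<^sub>R b))
      \<partial>(\<Pi>\<^sub>M b\<in>(Basis :: (real^'n) set). lborel))"
  proof -
    have [measurable]: "f \<in> borel_measurable borel"
      using cont by (rule borel_measurable_continuous_onI)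
    show ?thesis
      unfolding set_lebesgue_integral_def lborel_eq[where 'a = "real^'n"]
      by (rule integral_distr) measurable
  qed
  also have "\<dots> = plane_integral Basis f a"
    unfolding plane_integral_def set_lebesgue_integral_def
  proof (intro Bochner_Integration.integral_cong refl)
    fix t :: "real^'n \<Rightarrow> real" assume "t \<in> space (\<Pi>\<^sub>M b\<in>(Basis :: (real^'n) set). lborel)"
    then have "t \<in> extensional Basis" by (auto simp: space_PiM PiE_def)
    moreover have "(1 :: real^'n) \<bullet> b = 1" if "b \<in> Basis" for b
      using that by (auto simp: Basis_vec_def inner_axis)
    ultimately have "indicator (cbox 0 1) (\<Sum>b\<in>(Basis :: (real^'n) set). t b *\<^sub>R b) =
        (indicator (Basis \<rightarrow>\<^sub>E {0..1}) t :: real)"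
      by (auto simp: indicator_def mem_box PiE_def Pi_def)
    then show "indicator (cbox 0 1) (\<Sum>b\<in>(Basis :: (real^'n) set). t b *\<^sub>R b) *\<^sub>R
          f (a + (\<Sum>b\<in>Basis. t b *\<^sub>R b)) =
        indicator (Basis \<rightarrow>\<^sub>E {0..1}) t *\<^sub>R f (a + (\<Sum>v\<in>Basis. t v *\<^sub>R v))"
      by simp
  qed
  finally show ?thesis .
qed

lemma cube_integral_shift:
  fixes f :: "real^'n::finite \<Rightarrow> complex"
  assumes f: "f \<in> periodic_continuous"
  shows "integral (cbox 0 1) (\<lambda>x. f (x + a)) = integral (cbox 0 1) f"
proof -
  have basis: "(Basis :: (real^'n) set) \<subseteq> int_lattice"
    by (auto simp: Basis_vec_def)
  have "plane_integral Basis f (\<Sum>b\<in>B. c b *\<^sub>R b) = plane_integral Basis f 0"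
    if "finite B" "B \<subseteq> Basis" for B and c :: "real^'n \<Rightarrow> real"
    using that
  proof (induction B)
    case (insert b B)
    then show ?case
      using plane_integral_shift[of Basis b f "\<Sum>b\<in>B. c b *\<^sub>R b" "c b"] basis f
      by (simp add: add.commute)
  qed simp
  from this[of Basis "\<lambda>b. a \<bullet> b"] have "plane_integral Basis f a = plane_integral Basis f 0"
    by (simp add: euclidean_representation)
  then show ?thesis
    using cube_integral_eq_plane_integral[OF f, of a] cube_integral_eq_plane_integral[OF f, of 0]
    by (simp add: add.commute)
qed

text \<open>Fubini and translation invariance move the translation by \<open>t v\<close> from \<open>g\<close> to \<open>f\<close> with the opposite
sign; the sign disappears because \<open>v\<close> is an integer vector.\<close>

lemma segment_average_adjoint:
  fixes f g :: "real^'n::finite \<Rightarrow> complex"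
  assumes f: "f \<in> periodic_continuous" and g: "g \<in> periodic_continuous" and v: "v \<in> int_lattice"
  shows "integral (cbox 0 1) (\<lambda>x. f x * segment_average v g x) =
    integral (cbox 0 1) (\<lambda>x. segment_average v f x * g x)"
proof -
  have cont: "continuous_on UNIV f" "continuous_on UNIV g"
    using f g by (auto simp: periodic_continuous_def)
  have "continuous_on (cbox (0, 0) (1, 1)) (\<lambda>p. f (fst p) * g (fst p + snd p *\<^sub>R v))"
    by (intro continuous_intros continuous_on_compose2[OF cont(1)] continuous_on_compose2[OF cont(2)]) auto
  then have cont1: "continuous_on (cbox (0, 0) (1, 1)) (\<lambda>(x, t). f x * g (x + t *\<^sub>R v))"
    by (simp add: split_beta)
  have "continuous_on (cbox (0, 0) (1, 1)) (\<lambda>p. f (fst p + snd p *\<^sub>R (- v)) * g (fst p))"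
    by (intro continuous_intros continuous_on_compose2[OF cont(1)] continuous_on_compose2[OF cont(2)]) auto
  then have cont2: "continuous_on (cbox (0, 0) (1, 1)) (\<lambda>(x, t). f (x + t *\<^sub>R (- v)) * g x)"
    by (simp add: split_beta)
  have "integral (cbox 0 1) (\<lambda>x. f x * segment_average v g x) =
      integral (cbox 0 1) (\<lambda>x. integral (cbox 0 1) (\<lambda>t::real. f x * g (x + t *\<^sub>R v)))"
    by (simp add: line_average_def)
  also have "\<dots> = integral (cbox 0 1) (\<lambda>t::real. integral (cbox 0 1) (\<lambda>x. f x * g (x + t *\<^sub>R v)))"
    by (rule integral_swap_continuous[OF cont1])
  also have "\<dots> = integral (cbox 0 1) (\<lambda>t::real. integral (cbox 0 1) (\<lambda>x. f (x + t *\<^sub>R (- v)) * g x))"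
  proof (rule Henstock_Kurzweil_Integration.integral_cong)
    fix t :: real
    have "g (x + w + t *\<^sub>R v) = g (x + t *\<^sub>R v)" if "w \<in> int_lattice" for x w
      using periodic_continuous_shift[OF g that, of "x + t *\<^sub>R v"] by (simp add: add_ac)
    then have "(\<lambda>x. f x * g (x + t *\<^sub>R v)) \<in> periodic_continuous"
      using f by (auto simp: periodic_continuous_def intro!: continuous_intros
          continuous_on_compose2[OF cont(2)])
    from cube_integral_shift[OF this, of "t *\<^sub>R (- v)"]
    show "integral (cbox 0 1) (\<lambda>x. f x * g (x + t *\<^sub>R v)) =
        integral (cbox 0 1) (\<lambda>x. f (x + t *\<^sub>R (- v)) * g x)"
      by simp
  qed
  also have "\<dots> = integral (cbox 0 1) (\<lambda>x. integral (cbox 0 1) (\<lambda>t::real. f (x + t *\<^sub>R (- v)) * g x))"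
    by (rule integral_swap_continuous[OF cont2, symmetric])
  also have "\<dots> = integral (cbox 0 1) (\<lambda>x. segment_average (- v) f x * g x)"
    by (simp add: line_average_def)
  finally show ?thesis
    by (simp add: segment_average_reflect[OF f v])
qed

lemma plane_integral_adjoint:
  fixes f g :: "real^'n::finite \<Rightarrow> complex"
  assumes "finite A" "A \<subseteq> int_lattice" "f \<in> periodic_continuous" "g \<in> periodic_continuous"
  shows "integral (cbox 0 1) (\<lambda>x. f x * plane_integral A g x) =
    integral (cbox 0 1) (\<lambda>x. plane_integral A f x * g x)"
  using assms
proof (induction A arbitrary: g)
  case (insert v A)
  have P: "segment_average v h \<in> periodic_continuous" if "h \<in> periodic_continuous" for h
    using that by (intro line_average_periodic_continuous) auto
  show ?case
    using insert segment_average_adjoint[of "plane_integral A f" g v]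
      plane_integral_periodic_continuous[of A f] plane_integral_segment_average_commute[of A f v]
    by (simp add: plane_integral_insert P)
qed (simp add: plane_integral_empty)

section \<open>Fourier modes and smoothing in one coordinate\<close>

text \<open>The functions with a single frequency \<open>m\<close> in the coordinate \<open>i\<close>, characterised by how they
transform under translations.\<close>

definition axis_mode :: "'n::finite \<Rightarrow> int \<Rightarrow> (real^'n \<Rightarrow> complex) \<Rightarrow> bool" where
  "axis_mode i m g \<longleftrightarrow> (\<forall>x s. g (x + s *\<^sub>R axis i 1) = cis (2 * pi * (of_int m * s)) * g x)"

lemma axis_modes_imp_torus_character:
  fixes g :: "real^'n::finite \<Rightarrow> complex"
  assumes g: "\<And>i. axis_mode i (m i) g"
  shows "g = (\<lambda>x. g 0 * torus_character (\<chi> i. of_int (m i)) x)"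
proof
  fix x :: "real^'n"
  have "g (\<Sum>i\<in>I. (x $ i) *\<^sub>R axis i 1) = cis (2 * pi * (\<Sum>i\<in>I. of_int (m i) * x $ i)) * g 0"
    if "finite I" for I
    using that
  proof (induction I)
    case (insert i I)
    have "g ((\<Sum>i\<in>I. (x $ i) *\<^sub>R axis i 1) + (x $ i) *\<^sub>R axis i 1) =
        cis (2 * pi * (of_int (m i) * x $ i)) * g (\<Sum>i\<in>I. (x $ i) *\<^sub>R axis i 1)"
      using g[of i] unfolding axis_mode_def by blast
    then show ?case
      using insert by (simp add: add.commute cis_mult[symmetric] ring_distribs)
  qed simp
  from this[of UNIV] show "g x = g 0 * torus_character (\<chi> i. of_int (m i)) x"
    using basis_expansion[of x]
    by (simp add: torus_character_def inner_vec_def scalar_mult_eq_scaleR)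
qed

definition axis_fourier :: "'n::finite \<Rightarrow> int \<Rightarrow> (real^'n \<Rightarrow> complex) \<Rightarrow> real^'n \<Rightarrow> complex" where
  "axis_fourier i m = line_average (\<lambda>t. cis (- (2 * pi * (of_int m * t)))) (axis i 1)"

lemma axis_mode_axis_fourier:
  fixes g :: "real^'n::finite \<Rightarrow> complex"
  assumes g: "g \<in> periodic_continuous"
  shows "axis_mode i m (axis_fourier i m g)"
  unfolding axis_mode_def
proof (intro allI)
  fix x :: "real^'n" and s :: real
  let ?e = "\<lambda>r. cis (2 * pi * (of_int m * r))"
  define \<phi> where "\<phi> t = ?e (- t) * g (x + t *\<^sub>R axis i 1)" for t
  have cont: "continuous_on UNIV g" using g by (simp add: periodic_continuous_def)
  have F: "axis_fourier i m g y = integral {0..1} (\<lambda>t. ?e (- t) * g (y + t *\<^sub>R axis i 1))" for y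
    by (simp add: axis_fourier_def line_average_def)
  have "\<phi> (t + 1) = \<phi> t" for t
  proof -
    have "?e (- (t + 1)) = ?e (- t) * cis (2 * pi * of_int (- m))"
      by (simp add: cis_mult algebra_simps)
    then have "?e (- (t + 1)) = ?e (- t)"
      by (simp only: cis_2pi_int[OF Ints_of_int] mult_1_right)
    moreover have "g (x + (t + 1) *\<^sub>R axis i 1) = g (x + t *\<^sub>R axis i 1)"
      using periodic_continuous_shift[OF g axis_in_int_lattice, of "x + t *\<^sub>R axis i 1" i]
      by (simp add: algebra_simps)
    ultimately show ?thesis by (simp only: \<phi>_def)
  qed
  moreover have "continuous_on UNIV \<phi>"
    unfolding \<phi>_def by (intro continuous_intros continuous_on_compose2[OF cont]) auto
  ultimately have "integral {0..1} (\<lambda>t. \<phi> (t + s)) = integral {0..1} \<phi>"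
    by (intro integral_period_shift)
  moreover have "?e (- t) * g (x + s *\<^sub>R axis i 1 + t *\<^sub>R axis i 1) = ?e s * \<phi> (t + s)" for t
  proof -
    have "?e (- t) = ?e s * ?e (- (t + s))" by (simp add: cis_mult algebra_simps)
    then show ?thesis by (simp add: \<phi>_def algebra_simps)
  qed
  ultimately show "axis_fourier i m g (x + s *\<^sub>R axis i 1) = ?e s * axis_fourier i m g x"
    unfolding F[of "x + s *\<^sub>R axis i 1"] F[of x] \<phi>_def[symmetric] by simp
qed

lemma axis_mode_line_average:
  assumes "axis_mode i m g"
  shows "axis_mode i m (line_average k v g)"
  unfolding axis_mode_def
proof (intro allI)
  fix x s
  define c where "c = cis (2 * pi * (of_int m * s))"
  have "g (x + t *\<^sub>R v + s *\<^sub>R axis i 1) = c * g (x + t *\<^sub>R v)" for t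
    using assms unfolding axis_mode_def c_def by blast
  then have eq: "k t * g (x + s *\<^sub>R axis i 1 + t *\<^sub>R v) = c * (k t * g (x + t *\<^sub>R v))" for t
    by (simp add: add_ac mult.left_commute)
  show "line_average k v g (x + s *\<^sub>R axis i 1) = c * line_average k v g x"
    unfolding line_average_def eq by simp
qed

definition cos_power_mass :: "nat \<Rightarrow> real" where
  "cos_power_mass m = integral {0..1} (\<lambda>t. cos (pi * t) ^ (2 * m))"

text \<open>Integrating the derivative of \<open>sin (\<pi> t) cos (\<pi> t)\<^bsup>2m+1\<^esup>\<close> over a period and writing \<open>sin\<^sup>2\<close> as
\<open>1 - cos\<^sup>2\<close> gives two linear relations between the second moment and two consecutive masses.\<close>

lemma sin_sq_cos_power_integral:
  shows "integral {0..1} (\<lambda>t. (sin (pi * t))\<^sup>2 * cos (pi * t) ^ (2 * m)) =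
      cos_power_mass m / (2 * real m + 2)" (is "?J = _")
    and "cos_power_mass (Suc m) = (2 * real m + 1) * cos_power_mass m / (2 * real m + 2)"
proof -
  let ?s = "\<lambda>t. sin (pi * t)" and ?c = "\<lambda>t. cos (pi * t)"
  have int: "(\<lambda>t. ?c t ^ k) integrable_on {0..1}" "(\<lambda>t. (?s t)\<^sup>2 * ?c t ^ k) integrable_on {0..1}" for k
    by (intro integrable_continuous_real continuous_intros)+
  have "((\<lambda>t. pi * (?c t ^ (2 * Suc m)) - pi * (2 * real m + 1) * ((?s t)\<^sup>2 * ?c t ^ (2 * m))) has_integral
      ?s 1 * ?c 1 ^ (2 * m + 1) - ?s 0 * ?c 0 ^ (2 * m + 1)) {0..1}"
  proof (rule fundamental_theorem_of_calculus[where f = "\<lambda>t. ?s t * ?c t ^ (2 * m + 1)"])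
    fix t :: real
    have "((\<lambda>t. ?s t * ?c t ^ (2 * m + 1)) has_real_derivative
        pi * (?c t ^ (2 * Suc m)) - pi * (2 * real m + 1) * ((?s t)\<^sup>2 * ?c t ^ (2 * m))) (at t within {0..1})"
    proof (rule DERIV_cong, rule DERIV_mult)
      show "(?s has_real_derivative pi * ?c t) (at t within {0..1})"
        by (auto intro!: derivative_eq_intros)
      show "((\<lambda>t. ?c t ^ (2 * m + 1)) has_real_derivative
          of_nat (2 * m + 1) * (- pi * ?s t * ?c t ^ (2 * m + 1 - Suc 0))) (at t within {0..1})"
        by (intro DERIV_power) (auto intro!: derivative_eq_intros)
    qed (simp add: power2_eq_square algebra_simps)
    then show "((\<lambda>t. ?s t * ?c t ^ (2 * m + 1)) has_vector_derivative
        pi * (?c t ^ (2 * Suc m)) - pi * (2 * real m + 1) * ((?s t)\<^sup>2 * ?c t ^ (2 * m))) (at t within {0..1})"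
      by (simp only: has_real_derivative_iff_has_vector_derivative)
  qed simp
  then have "integral {0..1} (\<lambda>t. pi * (?c t ^ (2 * Suc m)) - pi * (2 * real m + 1) * ((?s t)\<^sup>2 * ?c t ^ (2 * m))) = 0"
    by (simp add: integral_unique del: mult_Suc_right)
  then have "pi * cos_power_mass (Suc m) - pi * (2 * real m + 1) * ?J = 0"
    by (subst (asm) Henstock_Kurzweil_Integration.integral_diff)
      (auto intro!: integrable_on_mult_right int simp: cos_power_mass_def simp del: mult_Suc_right)
  then have "pi * (cos_power_mass (Suc m) - (2 * real m + 1) * ?J) = 0"
    by (simp add: algebra_simps)
  then have 1: "cos_power_mass (Suc m) = (2 * real m + 1) * ?J" by simp
  have "(?s t)\<^sup>2 * ?c t ^ (2 * m) = ?c t ^ (2 * m) - ?c t ^ (2 * Suc m)" for t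
  proof -
    have "?c t ^ (2 * Suc m) = (?c t)\<^sup>2 * ?c t ^ (2 * m)"
      by (simp add: power2_eq_square)
    then show ?thesis by (simp only: sin_squared_eq left_diff_distrib mult_1_left)
  qed
  then have 2: "?J = cos_power_mass m - cos_power_mass (Suc m)"
    unfolding cos_power_mass_def
    by (simp only: Henstock_Kurzweil_Integration.integral_diff[OF int(1) int(1)])
  show 3: "?J = cos_power_mass m / (2 * real m + 2)"
    using 1 2 by (simp add: field_simps)
  show "cos_power_mass (Suc m) = (2 * real m + 1) * cos_power_mass m / (2 * real m + 2)"
    unfolding 1 3 by simp
qed

lemma cos_power_mass_pos: "0 < cos_power_mass m"
proof (induction m)
  case (Suc m)
  then show ?case by (simp add: sin_sq_cos_power_integral(2))
qed (simp add: cos_power_mass_def)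

text \<open>The kernel concentrates at \<open>t = 0\<close> (equivalently \<open>t = 1\<close>): its second moment has order \<open>1/m\<close>, so
its first moment has order \<open>1/\<surd>m\<close>.\<close>

lemma cos_power_sin_moment:
  "integral {0..1} (\<lambda>t. sin (pi * t) * cos (pi * t) ^ (2 * m)) \<le>
    2 * cos_power_mass m / sqrt (m + 1)"
proof -
  let ?s = "\<lambda>t. sin (pi * t)" and ?c = "\<lambda>t. cos (pi * t)" and ?r = "sqrt (real m + 1)"
  have int: "(\<lambda>t. ?c t ^ (2 * m)) integrable_on {0..1}" "(\<lambda>t. (?s t)\<^sup>2 * ?c t ^ (2 * m)) integrable_on {0..1}"
    "(\<lambda>t. ?s t * ?c t ^ (2 * m)) integrable_on {0..1}"
    by (intro integrable_continuous_real continuous_intros)+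
  have r: "0 < ?r" "?r * ?r = real m + 1" by auto
  have "integral {0..1} (\<lambda>t. ?s t * ?c t ^ (2 * m)) \<le>
      integral {0..1} (\<lambda>t. (1 / ?r) * ?c t ^ (2 * m) + ?r * ((?s t)\<^sup>2 * ?c t ^ (2 * m)))"
  proof (intro integral_le int Henstock_Kurzweil_Integration.integrable_add integrable_on_mult_right)
    fix t :: real
    \<comment> \<open>The weight \<open>\<surd>(m + 1)\<close> balances the mass of the kernel against its second moment.\<close>
    have "0 \<le> (1 - ?r * ?s t)\<^sup>2" by simp
    then have "2 * (?r * ?s t) \<le> 1 + (?r * ?s t)\<^sup>2"
      by (simp add: power2_eq_square algebra_simps)
    moreover have "0 \<le> 1 + (?r * ?s t)\<^sup>2" by simp
    ultimately have "?r * ?s t \<le> 1 + (?r * ?s t)\<^sup>2" by linarith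
    then have "?s t \<le> 1 / ?r + ?r * (?s t)\<^sup>2"
      using r by (simp add: field_simps power2_eq_square)
    then have "?s t * ?c t ^ (2 * m) \<le> (1 / ?r + ?r * (?s t)\<^sup>2) * ?c t ^ (2 * m)"
      by (intro mult_right_mono) (simp_all add: power_mult)
    then show "?s t * ?c t ^ (2 * m) \<le> (1 / ?r) * ?c t ^ (2 * m) + ?r * ((?s t)\<^sup>2 * ?c t ^ (2 * m))"
      by (simp add: algebra_simps)
  qed
  also have "\<dots> = (1 / ?r) * cos_power_mass m + ?r * (cos_power_mass m / (2 * real m + 2))"
    by (subst Henstock_Kurzweil_Integration.integral_add)
      (auto intro!: integrable_on_mult_right int
        simp: cos_power_mass_def[symmetric] sin_sq_cos_power_integral(1)
        simp del: times_divide_eq_left)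
  also have "\<dots> = (3 / 2) * cos_power_mass m / ?r"
  proof -
    have "r * (c / (2 * (r * r))) = c / (2 * r)" if "0 < r" for r c :: real
      using that by (simp add: field_simps)
    from this[OF r(1), of "cos_power_mass m"]
    have "?r * (cos_power_mass m / (2 * real m + 2)) = cos_power_mass m / (2 * ?r)"
      by (simp add: r(2))
    then show ?thesis by (simp add: add_divide_distrib[symmetric])
  qed
  also have "\<dots> \<le> 2 * cos_power_mass m / ?r"
    using cos_power_mass_pos[of m] r(1) by (intro divide_right_mono mult_right_mono) auto
  finally show ?thesis by (simp add: add.commute)
qed

text \<open>A crude form of Jordan's inequality. It lets \<open>sin (\<pi> t)\<close> bound the distance from \<open>t\<close> to the
nearest integer, and the moments of the sine against the kernel are computable.\<close>

lemma le_sin_pi: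
  fixes t :: real
  assumes "0 \<le> t" "t \<le> 1 / 2"
  shows "t \<le> sin (pi * t)"
proof (cases "t \<le> 1 / 3")
  case True
  show ?thesis
  proof (cases "t = 0")
    case False
    then have pos: "0 < pi * t" using assms by simp
    obtain z where z: "0 < z" "z < pi * t" "sin (pi * t) - sin 0 = (pi * t - 0) * cos z"
      using MVT2[OF pos, of sin cos] by auto
    have "pi * t \<le> pi * (1 / 3)" using True by (intro mult_left_mono) auto
    then have "z \<le> pi / 3" using z by linarith
    then have "cos (pi / 3) \<le> cos z"
      using z by (intro cos_monotone_0_pi_le) auto
    then have "pi * t * (1 / 2) \<le> pi * t * cos z"
      using pos by (intro mult_left_mono) (auto simp: cos_60)
    moreover have "t * 2 \<le> t * pi"
      using assms pi_gt3 by (intro mult_left_mono) auto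
    then have "t \<le> pi * t * (1 / 2)" by (simp add: mult.commute)
    moreover have "sin (pi * t) = pi * t * cos z" using z(3) by simp
    ultimately show ?thesis by linarith
  qed simp
next
  case False
  have "sin (pi / 6) \<le> sin (pi * t)"
    using False assms by (intro sin_monotone_2pi_le) (auto simp: field_simps)
  then show ?thesis using assms by (simp add: sin_30)
qed

lemma test_function_axis_lipschitz:
  fixes h :: "real^'n::finite \<Rightarrow> complex"
  assumes h: "h \<in> test_functions" and B: "\<And>x. cmod (partial_deriv j h x) \<le> B"
  shows "cmod (h (x + t *\<^sub>R axis j 1) - h (x + s *\<^sub>R axis j 1)) \<le> B * \<bar>t - s\<bar>"
proof -
  let ?D = "\<lambda>r s. s *\<^sub>R partial_deriv j h (x + r *\<^sub>R axis j 1)"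
  have "((\<lambda>r. h (x + r *\<^sub>R axis j 1)) has_derivative ?D r) (at r)" for r
  proof -
    have "((\<lambda>r. h (x + r *\<^sub>R axis j 1)) has_derivative
        (\<lambda>s. frechet_derivative h (at (x + r *\<^sub>R axis j 1)) (s *\<^sub>R axis j 1))) (at r)"
      by (rule has_derivative_compose[OF _ test_functions_frechet[OF h]])
        (auto intro!: derivative_eq_intros)
    then show ?thesis
      using has_derivative_bounded_linear[OF test_functions_frechet[OF h, of "x + r *\<^sub>R axis j 1"]]
      by (simp add: partial_deriv_def bounded_linear.linear linear_scale)
  qed
  moreover have "onorm (?D r) \<le> B" for r
    using B[of "x + r *\<^sub>R axis j 1"] by (intro onorm_le) (simp add: mult.commute[of B] mult_left_mono)
  ultimately have "norm (h (x + t *\<^sub>R axis j 1) - h (x + s *\<^sub>R axis j 1)) \<le> B * norm (t - s)"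
    by (intro differentiable_bound[where S = UNIV and f' = ?D]) auto
  then show ?thesis by simp
qed

definition axis_smoothing :: "'n::finite \<Rightarrow> nat \<Rightarrow> (real^'n \<Rightarrow> complex) \<Rightarrow> real^'n \<Rightarrow> complex" where
  "axis_smoothing j m =
     line_average (\<lambda>t. of_real (cos (pi * t) ^ (2 * m) / cos_power_mass m)) (axis j 1)"

text \<open>A Lipschitz function moves by at most \<open>B sin (\<pi> t)\<close> under translation by \<open>t\<close>: near \<open>t = 0\<close> it is
compared with its value at \<open>x\<close>, near \<open>t = 1\<close> with its value at \<open>x + e\<^sub>j\<close>, which is the same by
periodicity. The first moment of the kernel then bounds the error, uniformly in \<open>x\<close>.\<close>

lemma axis_smoothing_error:
  fixes h :: "real^'n::finite \<Rightarrow> complex"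
  assumes h: "h \<in> test_functions" and B: "\<And>x. cmod (partial_deriv j h x) \<le> B"
  shows "cmod (axis_smoothing j m h x - h x) \<le> 2 * B / sqrt (m + 1)"
proof -
  let ?K = "\<lambda>t. cos (pi * t) ^ (2 * m) / cos_power_mass m"
  let ?h = "\<lambda>t. h (x + t *\<^sub>R axis j 1)"
  have cont: "continuous_on {0..1} ?h"
    by (intro continuous_on_compose2[OF test_functions_continuous[OF h]] continuous_intros) auto
  have contK: "continuous_on {0..1} ?K"
    using cos_power_mass_pos[of m] by (intro continuous_intros) auto
  have B0: "0 \<le> B" using B[of x] norm_ge_zero order_trans by blast
  have osc: "cmod (?h t - h x) \<le> B * sin (pi * t)" if t: "t \<in> {0..1}" for t
  proof (cases "t \<le> 1 / 2")
    case True
    have "cmod (?h t - h x) \<le> B * t"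
      using test_function_axis_lipschitz[OF h B, of x t 0] t by simp
    also have "\<dots> \<le> B * sin (pi * t)"
      using le_sin_pi[of t] True t B0 by (intro mult_left_mono) auto
    finally show ?thesis .
  next
    case False
    have "cmod (?h t - h x) \<le> B * (1 - t)"
      using test_function_axis_lipschitz[OF h B, of x t 1] t
        test_functions_periodic[OF h axis_in_int_lattice, of x j] by simp
    also have "\<dots> \<le> B * sin (pi * (1 - t))"
      using le_sin_pi[of "1 - t"] False t B0 by (intro mult_left_mono) auto
    also have "sin (pi * (1 - t)) = sin (pi * t)"
      by (simp add: right_diff_distrib)
    finally show ?thesis .
  qed
  have "integral {0..1} (\<lambda>t. of_real (?K t) * h x) = integral {0..1} (\<lambda>t. of_real (?K t)) * h x"
    by simp
  also have "integral {0..1} (\<lambda>t. complex_of_real (?K t)) = of_real (integral {0..1} ?K)"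
    using has_integral_of_real[OF integrable_integral[OF integrable_continuous_real[OF contK]]]
    by (rule integral_unique)
  also have "integral {0..1} ?K = 1"
    using cos_power_mass_pos[of m] by (simp add: cos_power_mass_def)
  finally have "axis_smoothing j m h x - h x =
      integral {0..1} (\<lambda>t. of_real (?K t) * ?h t) - integral {0..1} (\<lambda>t. of_real (?K t) * h x)"
    by (simp add: axis_smoothing_def line_average_def)
  also have "\<dots> = integral {0..1} (\<lambda>t. of_real (?K t) * (?h t - h x))"
    unfolding right_diff_distrib
    by (intro Henstock_Kurzweil_Integration.integral_diff[symmetric] integrable_continuous_real
        continuous_intros cont continuous_on_of_real contK)
  also have "cmod \<dots> \<le> integral {0..1} (\<lambda>t. (B / cos_power_mass m) * (sin (pi * t) * cos (pi * t) ^ (2 * m)))"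
  proof (rule integral_norm_bound_integral)
    show "(\<lambda>t. of_real (?K t) * (?h t - h x)) integrable_on {0..1}"
      by (intro integrable_continuous_real continuous_intros cont continuous_on_of_real contK)
    show "(\<lambda>t. (B / cos_power_mass m) * (sin (pi * t) * cos (pi * t) ^ (2 * m))) integrable_on {0..1}"
      by (intro integrable_continuous_real continuous_intros)
    fix t :: real assume "t \<in> {0..1}"
    have "0 \<le> ?K t" using cos_power_mass_pos[of m] by (simp add: power_mult)
    then have "cmod (of_real (?K t) * (?h t - h x)) = ?K t * cmod (?h t - h x)"
      by (simp only: norm_mult norm_of_real abs_of_nonneg)
    also have "\<dots> \<le> ?K t * (B * sin (pi * t))"
      by (rule mult_left_mono) (fact osc[OF \<open>t \<in> {0..1}\<close>], fact \<open>0 \<le> ?K t\<close>)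
    finally have "cmod (of_real (?K t) * (?h t - h x)) \<le> ?K t * (B * sin (pi * t))" .
    then show "cmod (of_real (?K t) * (?h t - h x)) \<le>
        (B / cos_power_mass m) * (sin (pi * t) * cos (pi * t) ^ (2 * m))"
      by (simp add: mult_ac)
  qed
  also have "\<dots> = (B / cos_power_mass m) * integral {0..1} (\<lambda>t. sin (pi * t) * cos (pi * t) ^ (2 * m))"
    by simp
  also have "\<dots> \<le> (B / cos_power_mass m) * (2 * cos_power_mass m / sqrt (m + 1))"
    using B0 cos_power_mass_pos[of m] by (intro mult_left_mono cos_power_sin_moment) simp_all
  also have "\<dots> = 2 * B / sqrt (m + 1)"
    using cos_power_mass_pos[of m] by simp
  finally show ?thesis .
qed

section \<open>Distributions are determined by their Fourier coefficients\<close>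

text \<open>Smoothing commutes with derivatives, so the uniform estimate applies to each of the finitely many
derivatives that the seminorm sees.\<close>

lemma axis_smoothing_tendsto:
  fixes g :: "real^'n::finite \<Rightarrow> complex"
  assumes g: "g \<in> test_functions" and e: "0 < e"
  shows "\<forall>\<^sub>F m in sequentially. test_seminorm N (\<lambda>x. axis_smoothing j m g x - g x) < e"
proof -
  have cont: "continuous_on {0..1} (\<lambda>t. complex_of_real (cos (pi * t) ^ (2 * m) / cos_power_mass m))" for m
    using cos_power_mass_pos[of m] by (intro continuous_on_of_real continuous_intros) auto
  have smooth: "axis_smoothing j m h \<in> test_functions" if "h \<in> test_functions" for m h
    unfolding axis_smoothing_def by (rule line_average_test_functions[OF cont that])
  have pd: "partial_deriv i (axis_smoothing j m h) = axis_smoothing j m (partial_deriv i h)"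
    if "h \<in> test_functions" for i m h
    unfolding axis_smoothing_def by (rule partial_deriv_line_average[OF cont that])
  have md: "multi_deriv \<alpha> (\<lambda>x. axis_smoothing j m g x - g x) x =
      axis_smoothing j m (multi_deriv \<alpha> g) x - multi_deriv \<alpha> g x" for \<alpha> m x
    using multi_deriv_commute[of "axis_smoothing j m" g \<alpha>, OF smooth pd g]
    by (simp add: multi_deriv_diff[OF smooth[OF g] g])
  have "\<forall>\<^sub>F m in sequentially. \<forall>\<alpha>\<in>{\<alpha>. sum \<alpha> UNIV \<le> N}.
      \<forall>x. cmod (axis_smoothing j m (multi_deriv \<alpha> g) x - multi_deriv \<alpha> g x) \<le> e / 2"
  proof (rule eventually_ball_finite[OF finite_multi_indices], intro ballI)
    fix \<alpha> :: "'n \<Rightarrow> nat"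
    have h: "multi_deriv \<alpha> g \<in> test_functions" by (rule multi_deriv_test_functions[OF g])
    obtain B where B: "\<And>x. cmod (partial_deriv j (multi_deriv \<alpha> g) x) \<le> B"
      using periodic_continuous_bounded[OF test_functions_periodic_continuous
          [OF partial_deriv_test_functions[OF h]]] by blast
    have "filterlim (\<lambda>m. sqrt (real (m + 1))) at_top sequentially"
      by (intro filterlim_compose[OF sqrt_at_top] filterlim_compose[OF filterlim_real_sequentially]
          filterlim_add_const_nat_at_top)
    then have "(\<lambda>m. 2 * B / sqrt (real (m + 1))) \<longlonglongrightarrow> 0"
      by (intro tendsto_divide_0[OF tendsto_const] filterlim_at_top_imp_at_infinity)
    then have "\<forall>\<^sub>F m in sequentially. 2 * B / sqrt (real (m + 1)) < e / 2"
      using e by (intro order_tendstoD(2)) auto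
    then show "\<forall>\<^sub>F m in sequentially.
        \<forall>x. cmod (axis_smoothing j m (multi_deriv \<alpha> g) x - multi_deriv \<alpha> g x) \<le> e / 2"
    proof eventually_elim
      case (elim m)
      then show ?case
        by (intro allI order_trans[OF axis_smoothing_error[OF h B] less_imp_le])
    qed
  qed
  then show ?thesis
  proof eventually_elim
    case (elim m)
    then have "test_seminorm N (\<lambda>x. axis_smoothing j m g x - g x) \<le> e / 2"
      by (intro test_seminorm_least) (simp add: md)
    then show ?case using e by linarith
  qed
qed

lemma distribution_lincomb:
  assumes "u \<in> distributions" "f \<in> test_functions" "g \<in> test_functions"
  shows "u (\<lambda>x. a * f x + b * g x) = a * u f + b * u g"
  using assms by (simp add: distributions_def)

lemma distribution_scale:
  assumes "u \<in> distributions" "f \<in> test_functions"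
  shows "u (\<lambda>x. a * f x) = a * u f"
  using distribution_lincomb[OF assms assms(2), of a 0] by simp

lemma line_average_kernel_lincomb:
  fixes f :: "real^'n::finite \<Rightarrow> complex"
  assumes k: "continuous_on {0..1} k" "continuous_on {0..1} l" and f: "f \<in> periodic_continuous"
  shows "line_average (\<lambda>t. a * k t + b * l t) v f =
    (\<lambda>x. a * line_average k v f x + b * line_average l v f x)"
proof
  fix x
  have "(\<lambda>t. k t * f (x + t *\<^sub>R v)) integrable_on {0..1}"
    and "(\<lambda>t. l t * f (x + t *\<^sub>R v)) integrable_on {0..1}"
    using line_average_integrable k f by (auto simp: periodic_continuous_def)
  then have "integral {0..1} (\<lambda>t. a * (k t * f (x + t *\<^sub>R v)) + b * (l t * f (x + t *\<^sub>R v))) =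
      a * integral {0..1} (\<lambda>t. k t * f (x + t *\<^sub>R v)) + b * integral {0..1} (\<lambda>t. l t * f (x + t *\<^sub>R v))"
    by (subst Henstock_Kurzweil_Integration.integral_add) (auto intro: integrable_on_mult_right)
  then show "line_average (\<lambda>t. a * k t + b * l t) v f x =
      a * line_average k v f x + b * line_average l v f x"
    by (simp add: line_average_def algebra_simps)
qed

text \<open>The kernel is a trigonometric polynomial, so smoothing yields a linear combination of Fourier
modes. Its coefficients are not needed: from \<open>cos\<^sup>2 (\<pi> t) = 1/2 + (e(t) + e(-t))/4\<close>, where
\<open>e(t) = exp (2 \<pi> i t)\<close>, each power reduces to the previous one with the frequency shifted by at
most one, and induction over all frequencies at once concludes.\<close>

lemma distribution_axis_smoothing_eq_0:
  fixes g :: "real^'n::finite \<Rightarrow> complex"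
  assumes u: "u \<in> distributions" and g: "g \<in> test_functions"
    and modes: "\<And>l. u (axis_fourier j l g) = 0"
  shows "u (axis_smoothing j m g) = 0"
proof -
  let ?k = "\<lambda>l m t. cis (- (2 * pi * (of_int l * t))) * of_real (cos (pi * t) ^ (2 * m))"
  have cont: "continuous_on {0..1} (?k l m)" for l m
    by (intro continuous_intros continuous_on_of_real)
  define X where "X l m = line_average (?k l m) (axis j 1) g" for l m
  have X: "X l m \<in> test_functions" for l m
    unfolding X_def by (rule line_average_test_functions[OF cont g])
  have "u (X l m) = 0" for l
  proof (induction m arbitrary: l)
    case 0
    then show ?case using modes[of l] by (simp add: X_def axis_fourier_def)
  next
    case (Suc m)
    \<comment> \<open>The factor \<open>1\<close> gives the sum the shape of two nested binary linear combinations.\<close>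
    have "?k l (Suc m) t = 1 * ((1 / 2) * ?k l m t + (1 / 4) * ?k (l - 1) m t) + (1 / 4) * ?k (l + 1) m t" for t
    proof -
      let ?z = "cis (2 * pi * t)" and ?w = "cis (- (2 * pi * t))" and ?c = "cis (- (2 * pi * (of_int l * t)))"
      have 1: "(cos (pi * t))\<^sup>2 = (1 + cos (2 * pi * t)) / 2"
        using cos_double_cos[of "pi * t"] by (simp add: mult.assoc)
      have 2: "complex_of_real (cos (2 * pi * t)) = (?z + ?w) / 2"
        by (simp add: complex_eq_iff)
      have "complex_of_real ((cos (pi * t))\<^sup>2) = (1 + complex_of_real (cos (2 * pi * t))) / 2"
        unfolding 1 by (simp only: of_real_divide of_real_add of_real_1 of_real_numeral)
      then have "complex_of_real ((cos (pi * t))\<^sup>2) = 1 / 2 + ?z / 4 + ?w / 4"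
        unfolding 2 by (simp add: add_divide_distrib)
      moreover have "cis (- (2 * pi * (of_int (l - 1) * t))) = ?c * ?z"
        "cis (- (2 * pi * (of_int (l + 1) * t))) = ?c * ?w"
        by (simp_all add: cis_mult algebra_simps)
      moreover have "cos (pi * t) ^ (2 * Suc m) = (cos (pi * t))\<^sup>2 * cos (pi * t) ^ (2 * m)"
        by (simp add: power2_eq_square)
      ultimately show ?thesis
        by (simp only: of_real_mult) (simp add: algebra_simps)
    qed
    then have "X l (Suc m) =
        (\<lambda>x. 1 * ((1 / 2) * X l m x + (1 / 4) * X (l - 1) m x) + (1 / 4) * X (l + 1) m x)"
      unfolding X_def using cont test_functions_periodic_continuous[OF g]
      by (simp only: line_average_kernel_lincomb continuous_on_add continuous_on_mult continuous_on_const)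
    then show ?case
      by (simp only: distribution_lincomb[OF u test_functions_lincomb[OF X X] X]
          distribution_lincomb[OF u X X] Suc.IH mult_zero_right add_0_right)
  qed
  from this[of 0] have "u (X 0 m) = 0" .
  moreover have "axis_smoothing j m g = (\<lambda>x. of_real (1 / cos_power_mass m) * X 0 m x)"
    by (simp add: axis_smoothing_def X_def line_average_def[abs_def] divide_simps)
  ultimately show ?thesis
    by (simp only: distribution_scale[OF u X] mult_zero_right)
qed

text \<open>Induction on the set \<open>J\<close> of coordinates in which the test function is not yet a pure mode. For
\<open>J = {}\<close> it is a multiple of a character. Removing a coordinate \<open>j\<close> from \<open>J\<close> costs one smoothing
in that coordinate: its Fourier modes are covered by the induction hypothesis because an average
in one direction preserves the modes in the others, and the smoothed functions converge.\<close>

lemma distribution_eq_0_if_characters: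
  fixes u :: "(real^'n::finite \<Rightarrow> complex) \<Rightarrow> complex"
  assumes u: "u \<in> distributions"
    and characters: "\<And>k. k \<in> int_lattice \<Longrightarrow> u (torus_character k) = 0"
    and g: "g \<in> test_functions"
  shows "u g = 0"
proof -
  have "u h = 0" if "finite J" "h \<in> test_functions" "\<forall>i\<in>- J. \<exists>m. axis_mode i m h" for J h
    using that
  proof (induction J arbitrary: h)
    case empty
    then obtain m where "\<And>i. axis_mode i (m i) h" by (auto simp: choice_iff)
    then have h: "h = (\<lambda>x. h 0 * torus_character (\<chi> i. of_int (m i)) x)"
      by (rule axis_modes_imp_torus_character)
    have k: "(\<chi> i. of_int (m i)) \<in> (int_lattice :: (real^'n) set)"
      by (simp add: int_lattice_def)
    have "u h = u (\<lambda>x. h 0 * torus_character (\<chi> i. of_int (m i)) x)"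
      by (rule arg_cong[OF h])
    also have "\<dots> = h 0 * u (torus_character (\<chi> i. of_int (m i)))"
      by (rule distribution_scale[OF u]) (use torus_character_test_functions[OF k, of 1] in simp)
    finally show ?case by (simp add: characters[OF k])
  next
    case (insert j J)
    have "u (axis_fourier j l h) = 0" for l
    proof (rule insert.IH)
      show "axis_fourier j l h \<in> test_functions"
        unfolding axis_fourier_def using insert.prems
        by (intro line_average_test_functions continuous_intros)
      have "axis_mode j l (axis_fourier j l h)"
        using insert.prems by (intro axis_mode_axis_fourier test_functions_periodic_continuous)
      moreover have "\<exists>m. axis_mode i m (axis_fourier j l h)" if "i \<notin> insert j J" for i
        using insert.prems that axis_mode_line_average unfolding axis_fourier_def by blast
      ultimately show "\<forall>i\<in>- J. \<exists>m. axis_mode i m (axis_fourier j l h)"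
        by (metis ComplD insertE)
    qed
    then have "u (axis_smoothing j m h) = 0" for m
      using insert.prems by (intro distribution_axis_smoothing_eq_0[OF u]) auto
    moreover have "(\<lambda>m. u (axis_smoothing j m h)) \<longlonglongrightarrow> u h"
    proof (rule continuous_functional_tendsto[where u = u and g = "\<lambda>m. axis_smoothing j m h"])
      show "continuous_map test_topology euclidean u" using u by (simp add: distributions_def)
      show "axis_smoothing j m h \<in> test_functions" for m
        unfolding axis_smoothing_def using insert.prems cos_power_mass_pos[of m]
        by (intro line_average_test_functions continuous_on_of_real continuous_intros) auto
    qed (use insert.prems axis_smoothing_tendsto in auto)
    ultimately show ?case by (simp add: LIMSEQ_const_iff)
  qed
  from this[of UNIV g] show ?thesis using g by simp
qed

section \<open>Characters fixed by the transform\<close>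

text \<open>The character is constant on the planes that are integrated over.\<close>

lemma plane_integral_torus_character:
  assumes k: "k \<in> int_lattice" and "finite A" "\<And>v. v \<in> A \<Longrightarrow> k \<bullet> v = 0"
  shows "plane_integral A (torus_character k) = torus_character k"
  using assms(2,3)
proof (induction A)
  case (insert v A)
  have "torus_character k (x + t *\<^sub>R v) = torus_character k x" for x t
    using insert.prems[of v] by (simp add: torus_character_def inner_add_right)
  then have "segment_average v (torus_character k) = torus_character k"
    by (simp add: line_average_def[abs_def])
  then show ?case
    using insert torus_character_test_functions[OF k, of 1]
    by (simp add: plane_integral_insert test_functions_periodic_continuous)
qed (simp add: plane_integral_empty)

text \<open>For \<open>c\<^sub>j \<noteq> 0\<close> the \<open>n - 1\<close> integer vectors \<open>c\<^sub>j e\<^sub>i - c\<^sub>i e\<^sub>j\<close> with \<open>i \<noteq> j\<close> are orthogonal to \<open>c\<close>. They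
are independent because in the coordinates other than \<open>j\<close> they form a nonzero multiple of the
standard basis. This is where \<open>d < n\<close> enters.\<close>

lemma orthogonal_direction_set:
  fixes k :: "real^'n::finite"
  assumes k: "k \<in> int_lattice" and d: "d < CARD('n)"
  obtains A :: "(real^'n) set" where "A \<in> direction_sets d" "\<And>v. v \<in> A \<Longrightarrow> k \<bullet> v = 0"
proof -
  obtain c :: "real^'n" and j where c: "c \<in> int_lattice" "c $ j \<noteq> 0" "\<And>v. c \<bullet> v = 0 \<Longrightarrow> k \<bullet> v = 0"
  proof (cases "k = 0")
    \<comment> \<open>Every vector is orthogonal to \<open>k = 0\<close>, so any coordinate vector may stand in for \<open>k\<close>.\<close>
    case True
    show ?thesis by (rule that[of "axis undefined 1" undefined]) (auto simp: True)
  next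
    case False
    then obtain j where "k $ j \<noteq> 0" by (auto simp: vec_eq_iff)
    then show ?thesis using k by (intro that[of k j]) auto
  qed
  define w where "w i = (c $ j) *\<^sub>R axis i 1 - (c $ i) *\<^sub>R axis j (1 :: real)" for i :: 'n
  have comp: "w i $ i' = (if i' = i then c $ j else 0)" if "i \<noteq> j" "i' \<noteq> j" for i i'
    using that by (simp add: w_def axis_def)
  have "d \<le> card (UNIV - {j})" using d by (simp add: card_Diff_singleton)
  then obtain I where I: "I \<subseteq> UNIV - {j}" "card I = d" "finite I"
    by (meson obtain_subset_with_card_n)
  have ne: "i \<noteq> j" if "i \<in> I" for i using that I by auto
  have inj: "inj_on w I"
  proof (rule inj_onI)
    fix i i' assume "i \<in> I" "i' \<in> I" "w i = w i'"
    then show "i = i'" using comp[of i i] comp[of i' i] ne c(2) by (auto split: if_splits)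
  qed
  show ?thesis
  proof (rule that[of "w ` I"])
    have "w i \<in> int_lattice - {0}" if "i \<in> I" for i
    proof -
      have "w i \<in> int_lattice"
        using c(1) by (auto simp: int_lattice_def w_def axis_def)
      moreover have "w i \<noteq> 0"
        using comp[of i i] ne[OF that] c(2) by auto
      ultimately show ?thesis by simp
    qed
    moreover have "independent (w ` I)"
    proof (rule independent_if_scalars_zero)
      fix a x assume a: "(\<Sum>x\<in>w ` I. a x *\<^sub>R x) = 0" and "x \<in> w ` I"
      then obtain i where i: "i \<in> I" "x = w i" by auto
      have "0 = (\<Sum>i'\<in>I. a (w i') *\<^sub>R w i') $ i"
        using a by (simp add: sum.reindex[OF inj] o_def)
      also have "\<dots> = (\<Sum>i'\<in>I. if i' = i then a (w i') * c $ j else 0)"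
        using ne i(1) by (simp add: comp if_distrib eq_commute cong: sum.cong if_cong)
      also have "\<dots> = a x * c $ j" using i I(3) by simp
      finally show "a x = 0" using c(2) by simp
    qed (use I in auto)
    ultimately show "w ` I \<in> direction_sets d"
      using I card_image[OF inj] by (auto simp: direction_sets_def)
    show "k \<bullet> v = 0" if "v \<in> w ` I" for v
    proof (rule c(3))
      show "c \<bullet> v = 0" using that by (auto simp: w_def inner_diff_right inner_axis)
    qed
  qed
qed

lemma direction_sets_finite: "A \<in> direction_sets d \<Longrightarrow> 1 \<le> d \<Longrightarrow> finite A"
  by (auto simp: direction_sets_def intro: card_ge_0_finite)

section \<open>Functions as distributions\<close>

lemma distribution_of_eq_integral:
  fixes f :: "real^'n::finite \<Rightarrow> complex"
  assumes f: "f \<in> test_functions" and g: "g \<in> test_functions"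
  shows "distribution_of f g = integral (cbox 0 1) (\<lambda>x. f x * g x)"
    and "(\<lambda>x. f x * g x) integrable_on cbox 0 1"
proof -
  have "continuous_on (cbox 0 1) (\<lambda>x. f x * g x)"
    by (intro continuous_intros continuous_on_subset[OF test_functions_continuous] f g) auto
  then have "set_integrable lborel (cbox 0 1) (\<lambda>x. f x * g x)"
    unfolding set_integrable_def by (intro borel_integrable_compact) auto
  then show "distribution_of f g = integral (cbox 0 1) (\<lambda>x. f x * g x)"
    and "(\<lambda>x. f x * g x) integrable_on cbox 0 1"
    using g by (simp_all add: distribution_of_def set_borel_integral_eq_integral)
qed

lemma distribution_of_distributions:
  fixes f :: "real^'n::finite \<Rightarrow> complex"
  assumes f: "f \<in> test_functions"
  shows "distribution_of f \<in> distributions"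
proof -
  have lin: "distribution_of f (\<lambda>x. a * g x + b * h x) =
      a * distribution_of f g + b * distribution_of f h"
    if "g \<in> test_functions" "h \<in> test_functions" for g h a b
  proof -
    have "integral (cbox 0 1) (\<lambda>x. a * (f x * g x) + b * (f x * h x)) =
        a * integral (cbox 0 1) (\<lambda>x. f x * g x) + b * integral (cbox 0 1) (\<lambda>x. f x * h x)"
      using that f by (subst Henstock_Kurzweil_Integration.integral_add)
        (auto intro: integrable_on_mult_right distribution_of_eq_integral(2))
    then show ?thesis
      using that f by (simp add: distribution_of_eq_integral(1) test_functions_lincomb algebra_simps)
  qed
  obtain B where B: "\<And>x. cmod (f x) \<le> B"
    using periodic_continuous_bounded[OF test_functions_periodic_continuous[OF f]] by blast
  have "continuous_map test_topology euclidean (distribution_of f)"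
  proof (rule continuous_map_test_topology_functional[where N = 0])
    fix g h :: "real^'n \<Rightarrow> complex"
    assume gh: "g \<in> test_functions" "h \<in> test_functions"
    let ?q = "\<lambda>x. g x - h x"
    have q: "?q \<in> test_functions" using gh by (rule test_functions_diff)
    have "distribution_of f g - distribution_of f h = distribution_of f ?q"
      using lin[OF gh, of 1 "-1"] by simp
    also have "cmod \<dots> \<le> (B * test_seminorm 0 ?q) * measure lborel (cbox (0 :: real^'n) 1)"
    proof (rule has_integral_bound)
      have "0 \<le> B" "0 \<le> test_seminorm 0 ?q"
        using B[of 0] cmod_le_seminorm[OF q, of 0 0] norm_ge_zero order_trans by blast+
      then show "0 \<le> B * test_seminorm 0 ?q" by simp
      show "((\<lambda>x. f x * ?q x) has_integral distribution_of f ?q) (cbox 0 1)"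
        using distribution_of_eq_integral[OF f q] by (simp add: has_integral_integrable_integral)
      show "cmod (f x * ?q x) \<le> B * test_seminorm 0 ?q" for x
        unfolding norm_mult using B[of x] cmod_le_seminorm[OF q, of x 0] \<open>0 \<le> B\<close>
        by (intro mult_mono) auto
    qed
    finally show "cmod (distribution_of f g - distribution_of f h) \<le>
        (B * measure lborel (cbox (0 :: real^'n) 1)) * test_seminorm 0 ?q"
      by (simp add: mult_ac)
  qed
  then show ?thesis
    using lin by (auto simp: distributions_def distribution_of_def)
qed

text \<open>Pairing \<open>f - g\<close> with its complex conjugate gives \<open>\<integral>\<bar>f - g\<bar>\<^sup>2 = 0\<close>, and a continuous nonnegative
function with zero integral vanishes on the cube.\<close>

lemma distribution_of_inj:
  fixes f g :: "real^'n::finite \<Rightarrow> complex"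
  assumes f: "f \<in> test_functions" and g: "g \<in> test_functions"
    and eq: "distribution_of f = distribution_of g"
  shows "f = g"
proof
  fix x
  let ?q = "\<lambda>x. f x - g x"
  have q: "?q \<in> test_functions" "(\<lambda>x. cnj (?q x)) \<in> test_functions"
    using test_functions_diff[OF f g] test_functions_cnj by blast+
  have int: "((\<lambda>x. p x * cnj (?q x)) has_integral distribution_of p (\<lambda>x. cnj (?q x))) (cbox 0 1)"
    if "p \<in> test_functions" for p
    using distribution_of_eq_integral[OF that q(2)] by (simp add: has_integral_integrable_integral)
  have "((\<lambda>x. ?q x * cnj (?q x)) has_integral 0) (cbox 0 1)"
    using has_integral_diff[OF int[OF f] int[OF g]] by (simp add: eq left_diff_distrib)
  then have "((\<lambda>x. complex_of_real ((cmod (?q x))\<^sup>2)) has_integral 0) (cbox 0 1)"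
    by (simp only: complex_norm_square)
  from has_integral_Re[OF this] have 0: "((\<lambda>x. (cmod (?q x))\<^sup>2) has_integral 0) (cbox 0 1)"
    by simp
  have cont: "continuous_on (cbox 0 1) (\<lambda>x. (cmod (?q x))\<^sup>2)"
    by (intro continuous_intros continuous_on_subset[OF test_functions_continuous] f g) auto
  obtain y v :: "real^'n" where yv: "y \<in> cbox 0 1" "v \<in> int_lattice" "x = y + v"
    by (rule unit_cube_representative)
  have "(cmod (?q y))\<^sup>2 = 0"
  proof (rule has_integral_0_cbox_imp_0[OF cont _ 0 _ yv(1)])
    show "box 0 (1 :: real^'n) \<noteq> {}"
      by (simp add: box_ne_empty Basis_vec_def) (auto simp: inner_axis)
  qed simp
  then show "f x = g x"
    using yv test_functions_periodic[OF f] test_functions_periodic[OF g] by simp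
qed

section \<open>The Radon transform on functions and distributions\<close>

lemma radon_test_functions:
  fixes f :: "real^'n::finite \<Rightarrow> complex"
  assumes "f \<in> test_functions" "A \<in> direction_sets d" "1 \<le> d"
  shows "radon d f A \<in> test_functions"
  using assms by (simp add: radon_eq_plane_integral plane_integral_test_functions direction_sets_finite)

lemma radon_lincomb:
  fixes f g :: "real^'n::finite \<Rightarrow> complex"
  assumes "f \<in> test_functions" "g \<in> test_functions" "A \<in> direction_sets d" "1 \<le> d"
  shows "radon d (\<lambda>x. a * f x + b * g x) A = (\<lambda>x. a * radon d f A x + b * radon d g A x)"
  using assms by (simp add: radon_eq_plane_integral plane_integral_lincomb direction_sets_finite
      test_functions_periodic_continuous)

lemma multi_deriv_radon:
  fixes f :: "real^'n::finite \<Rightarrow> complex"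
  assumes "f \<in> test_functions" "A \<in> direction_sets d" "1 \<le> d"
  shows "multi_deriv \<alpha> (radon d f A) = radon d (multi_deriv \<alpha> f) A"
proof -
  have "finite A" using assms direction_sets_finite by blast
  then show ?thesis
    using multi_deriv_commute[of "plane_integral A" f \<alpha>] assms
    by (simp add: radon_eq_plane_integral plane_integral_test_functions partial_deriv_plane_integral)
qed

lemma test_seminorm_radon:
  fixes f :: "real^'n::finite \<Rightarrow> complex"
  assumes f: "f \<in> test_functions" and A: "A \<in> direction_sets d" "1 \<le> d"
  shows "test_seminorm N (radon d f A) \<le> test_seminorm N f"
proof (rule test_seminorm_least)
  fix \<alpha> :: "'n \<Rightarrow> nat" and x assume \<alpha>: "sum \<alpha> UNIV \<le> N"
  have "cmod (plane_integral A (multi_deriv \<alpha> f) x) \<le> test_seminorm N f"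
    using A f \<alpha> by (intro plane_integral_bound cmod_multi_deriv_le_seminorm direction_sets_finite
        test_functions_periodic_continuous multi_deriv_test_functions)
  then show "cmod (multi_deriv \<alpha> (radon d f A) x) \<le> test_seminorm N f"
    using multi_deriv_radon[OF f A] A by (simp add: radon_eq_plane_integral)
qed

lemma continuous_map_radon:
  fixes A :: "(real^'n::finite) set"
  assumes A: "A \<in> direction_sets d" "1 \<le> d"
  shows "continuous_map test_topology test_topology (\<lambda>f. radon d f A)"
proof (rule continuous_map_test_topology_contraction)
  fix N and f g :: "real^'n \<Rightarrow> complex"
  assume fg: "f \<in> test_functions" "g \<in> test_functions"
  have "radon d (\<lambda>x. f x - g x) A = (\<lambda>x. radon d f A x - radon d g A x)"
    using radon_lincomb[OF fg A, of 1 "-1"] by simp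
  then show "test_seminorm N (\<lambda>x. radon d f A x - radon d g A x) \<le> test_seminorm N (\<lambda>x. f x - g x)"
    using test_seminorm_radon[OF test_functions_diff[OF fg] A, of N] by simp
qed (use A radon_test_functions in blast)

lemma radon_distr_apply:
  "A \<in> direction_sets d \<Longrightarrow> \<eta> \<in> test_functions \<Longrightarrow> radon_distr d u A \<eta> = u (radon d \<eta> A)"
  by (simp add: radon_distr_def)

lemma radon_distr_distributions:
  fixes u :: "(real^'n::finite \<Rightarrow> complex) \<Rightarrow> complex"
  assumes u: "u \<in> distributions" and A: "A \<in> direction_sets d" "1 \<le> d"
  shows "radon_distr d u A \<in> distributions"
proof -
  have "continuous_map test_topology euclidean (u \<circ> (\<lambda>f. radon d f A))"
    using continuous_map_radon[OF A] u by (intro continuous_map_compose) (auto simp: distributions_def)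
  then have "continuous_map test_topology euclidean (radon_distr d u A)"
    by (rule continuous_map_eq) (simp add: topspace_test_topology radon_distr_apply A)
  moreover have "radon_distr d u A (\<lambda>x. a * f x + b * g x) =
      a * radon_distr d u A f + b * radon_distr d u A g"
    if "f \<in> test_functions" "g \<in> test_functions" for f g a b
    using that A u by (simp add: radon_distr_apply test_functions_lincomb radon_lincomb
        distribution_lincomb radon_test_functions)
  moreover have "radon_distr d u A \<in> extensional test_functions"
    using A by (simp add: radon_distr_def)
  ultimately show ?thesis by (simp add: distributions_def)
qed

lemma radon_distr_distribution_of:
  fixes f :: "real^'n::finite \<Rightarrow> complex"
  assumes f: "f \<in> test_functions" and A: "A \<in> direction_sets d" "1 \<le> d"
  shows "radon_distr d (distribution_of f) A = distribution_of (radon d f A)"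
proof (rule extensionalityI[where A = test_functions])
  fix \<eta> :: "real^'n \<Rightarrow> complex" assume \<eta>: "\<eta> \<in> test_functions"
  have "A \<subseteq> int_lattice" using A by (auto simp: direction_sets_def)
  then have "integral (cbox 0 1) (\<lambda>x. f x * radon d \<eta> A x) = integral (cbox 0 1) (\<lambda>x. radon d f A x * \<eta> x)"
    using plane_integral_adjoint[of A f \<eta>] A f \<eta>
    by (simp add: radon_eq_plane_integral direction_sets_finite test_functions_periodic_continuous)
  then show "radon_distr d (distribution_of f) A \<eta> = distribution_of (radon d f A) \<eta>"
    using f \<eta> A by (simp add: radon_distr_apply distribution_of_eq_integral radon_test_functions)
qed (use A in \<open>auto simp: radon_distr_def distribution_of_def\<close>)

text \<open>The transform determines the pairing with every character: \<open>k\<close> is tested on directions orthogonal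
to it, where the character is its own transform. The difference of two distributions with the
same transform hence has no Fourier coefficients.\<close>

lemma inj_on_radon_distr:
  assumes "1 \<le> d" and d: "d < CARD('n::finite)"
  shows "inj_on (radon_distr d) (distributions :: ((real^'n \<Rightarrow> complex) \<Rightarrow> complex) set)"
proof (rule inj_onI)
  fix u w :: "(real^'n \<Rightarrow> complex) \<Rightarrow> complex"
  assume u: "u \<in> distributions" and w: "w \<in> distributions" and eq: "radon_distr d u = radon_distr d w"
  have characters: "u (torus_character k) = w (torus_character k)" if k: "k \<in> int_lattice" for k
  proof -
    obtain A :: "(real^'n) set" where A: "A \<in> direction_sets d" "\<And>v. v \<in> A \<Longrightarrow> k \<bullet> v = 0"
      using orthogonal_direction_set[OF k d] by blast
    have "torus_character k \<in> test_functions"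
      using torus_character_test_functions[OF k, of 1] by simp
    moreover have "radon d (torus_character k) A = torus_character k"
      using plane_integral_torus_character[OF k] A assms
      by (simp add: radon_eq_plane_integral direction_sets_finite)
    ultimately show ?thesis
      using fun_cong[OF fun_cong[OF eq, of A], of "torus_character k"] A
      by (simp add: radon_distr_apply)
  qed
  define z where "z = (\<lambda>\<eta>\<in>test_functions. u \<eta> - w \<eta>)"
  have z: "z \<in> distributions"
  proof -
    have "continuous_map test_topology euclidean (\<lambda>\<eta>. u \<eta> - w \<eta>)"
      using u w by (intro continuous_map_diff) (auto simp: distributions_def)
    then have "continuous_map test_topology euclidean z"
      by (rule continuous_map_eq) (simp add: z_def topspace_test_topology)
    moreover have "z (\<lambda>x. a * f x + b * g x) = a * z f + b * z g"
      if "f \<in> test_functions" "g \<in> test_functions" for f g a b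
      using that by (simp add: z_def test_functions_lincomb distribution_lincomb[OF u]
          distribution_lincomb[OF w] algebra_simps)
    ultimately show ?thesis by (simp add: distributions_def z_def)
  qed
  show "u = w"
  proof (rule extensionalityI[where A = test_functions])
    fix \<eta> :: "real^'n \<Rightarrow> complex" assume \<eta>: "\<eta> \<in> test_functions"
    have "z (torus_character k) = 0" if "k \<in> int_lattice" for k
      using characters[OF that] torus_character_test_functions[OF that, of 1] by (simp add: z_def)
    then have "z \<eta> = 0" by (rule distribution_eq_0_if_characters[OF z _ \<eta>])
    then show "u \<eta> = w \<eta>" using \<eta> by (simp add: z_def)
  qed (use u w in \<open>auto simp: distributions_def\<close>)
qed

text \<open>The distributional transform of the distribution given by \<open>f\<close> depends only on the transform of
\<open>f\<close>, so the uniqueness for distributions applies.\<close>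

lemma inj_on_radon:
  assumes d: "1 \<le> d" "d < CARD('n::finite)"
  shows "inj_on (radon d) (test_functions :: (real^'n \<Rightarrow> complex) set)"
proof (rule inj_onI)
  fix f g :: "real^'n \<Rightarrow> complex"
  assume f: "f \<in> test_functions" and g: "g \<in> test_functions" and eq: "radon d f = radon d g"
  have "radon_distr d (distribution_of f) = radon_distr d (distribution_of g)"
  proof
    fix A :: "(real^'n) set"
    show "radon_distr d (distribution_of f) A = radon_distr d (distribution_of g) A"
    proof (cases "A \<in> direction_sets d")
      case True
      then show ?thesis using f g d eq by (simp add: radon_distr_distribution_of)
    qed (simp add: radon_distr_def)
  qed
  then have "distribution_of f = distribution_of g"
    using inj_on_radon_distr[OF d] distribution_of_distributions[OF f] distribution_of_distributions[OF g]
    by (auto dest: inj_onD)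
  then show "f = g" by (rule distribution_of_inj[OF f g])
qed

lemma topspace_weak_star_topology: "topspace weak_star_topology = distributions"
  by (auto simp: weak_star_topology_def distributions_def PiE_def)

lemma continuous_map_radon_distr:
  fixes A :: "(real^'n::finite) set"
  assumes A: "A \<in> direction_sets d" "1 \<le> d"
  shows "continuous_map weak_star_topology weak_star_topology (\<lambda>u. radon_distr d u A)"
proof -
  have "continuous_map weak_star_topology (product_topology (\<lambda>_. euclidean) test_functions)
      (\<lambda>u. radon_distr d u A)"
    unfolding continuous_map_componentwise
  proof (intro conjI ballI)
    show "(\<lambda>u. radon_distr d u A) ` topspace weak_star_topology \<subseteq> extensional test_functions"
      using A by (auto simp: radon_distr_def)
    fix \<eta> :: "real^'n \<Rightarrow> complex" assume \<eta>: "\<eta> \<in> test_functions"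
    have "continuous_map weak_star_topology euclidean (\<lambda>u. u (radon d \<eta> A))"
      unfolding weak_star_topology_def
      by (intro continuous_map_from_subtopology continuous_map_product_projection radon_test_functions A \<eta>)
    then show "continuous_map weak_star_topology euclidean (\<lambda>u. radon_distr d u A \<eta>)"
      using A \<eta> by (simp add: radon_distr_apply)
  qed
  then have "continuous_map weak_star_topology
      (subtopology (product_topology (\<lambda>_. euclidean) test_functions) distributions)
      (\<lambda>u. radon_distr d u A)"
    using radon_distr_distributions[OF _ A]
    by (auto simp: continuous_map_in_subtopology topspace_weak_star_topology)
  then show ?thesis by (simp only: weak_star_topology_def[symmetric])
qed

theorem theorem2:
  fixes d :: nat
  assumes "2 \<le> CARD('n::finite)" and "1 \<le> d" and "d < CARD('n)"
  shows
    "radon d \<in> (test_functions :: (real^'n \<Rightarrow> complex) set) \<rightarrow>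
       (direction_sets d \<rightarrow>\<^sub>E test_functions) \<and>
     inj_on (radon d) (test_functions :: (real^'n \<Rightarrow> complex) set) \<and>
     (\<forall>f\<in>(test_functions :: (real^'n \<Rightarrow> complex) set). \<forall>g\<in>test_functions. \<forall>a b.
       \<forall>A\<in>direction_sets d.
         radon d (\<lambda>x. a * f x + b * g x) A = (\<lambda>x. a * radon d f A x + b * radon d g A x)) \<and>
     (\<forall>A\<in>(direction_sets d :: (real^'n) set set).
       continuous_map test_topology test_topology (\<lambda>f. radon d f A)) \<and>
     distribution_of \<in> (test_functions :: (real^'n \<Rightarrow> complex) set) \<rightarrow> distributions \<and>
     (\<forall>f\<in>(test_functions :: (real^'n \<Rightarrow> complex) set). \<forall>A\<in>direction_sets d.
       radon_distr d (distribution_of f) A = distribution_of (radon d f A)) \<and>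
     radon_distr d \<in> (distributions :: ((real^'n \<Rightarrow> complex) \<Rightarrow> complex) set) \<rightarrow>
       (direction_sets d \<rightarrow>\<^sub>E distributions) \<and>
     inj_on (radon_distr d) (distributions :: ((real^'n \<Rightarrow> complex) \<Rightarrow> complex) set) \<and>
     (\<forall>u\<in>(distributions :: ((real^'n \<Rightarrow> complex) \<Rightarrow> complex) set). \<forall>w\<in>distributions. \<forall>a b.
       \<forall>A\<in>direction_sets d.
         radon_distr d (\<lambda>\<eta>\<in>test_functions. a * u \<eta> + b * w \<eta>) A =
           (\<lambda>\<eta>\<in>test_functions. a * radon_distr d u A \<eta> + b * radon_distr d w A \<eta>)) \<and>
     (\<forall>A\<in>(direction_sets d :: (real^'n) set set).
       continuous_map weak_star_topology weak_star_topology (\<lambda>u. radon_distr d u A))"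
proof (intro conjI ballI allI)
  show "radon d \<in> (test_functions :: (real^'n \<Rightarrow> complex) set) \<rightarrow>
      (direction_sets d \<rightarrow>\<^sub>E test_functions)"
    using assms(2) by (intro funcsetI PiE_I radon_test_functions) (auto simp: radon_def)
  show "radon_distr d \<in> (distributions :: ((real^'n \<Rightarrow> complex) \<Rightarrow> complex) set) \<rightarrow>
      (direction_sets d \<rightarrow>\<^sub>E distributions)"
    using assms(2) by (intro funcsetI PiE_I radon_distr_distributions) (auto simp: radon_distr_def)
  show "radon_distr d (\<lambda>\<eta>\<in>test_functions. a * u \<eta> + b * w \<eta>) A =
      (\<lambda>\<eta>\<in>test_functions. a * radon_distr d u A \<eta> + b * radon_distr d w A \<eta>)"
    if "A \<in> direction_sets d" for u w :: "(real^'n \<Rightarrow> complex) \<Rightarrow> complex" and a b A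
    using that assms(2) by (auto simp: radon_distr_def radon_test_functions fun_eq_iff)
qed (use assms in \<open>auto simp: inj_on_radon inj_on_radon_distr radon_lincomb continuous_map_radon
      continuous_map_radon_distr distribution_of_distributions radon_distr_distribution_of\<close>)

end
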